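(* Fix $\lambda>0$ and $z>0$. The process $\zeta^{\lambda,z}_t=(\mathbb{I}_{\{t<\sigma_z^\lambda\}},\xi^{\lambda,z}_t)$, $t\ge0$, is a Feller process on $\{0,1\}\times\mathbb{R}$; that is, it is a Markov process whose semigroup $Q^{\lambda,z}=(Q^{\lambda,z}_t)_{t\ge 0}$ satisfies: (i) $Q^{\lambda,z}_th(y)\to h(y)$ as $t\to0$, for all $h\in C_0(\{0,1\}\times\mathbb{R})$ and $y=(y_1,y_2)\in\{0,1\}\times\mathbb{R}$; (ii) $Q^{\lambda,z}_t\,C_0(\{0,1\}\times\mathbb{R})\subset C_0(\{0,1\}\times\mathbb{R})$ for all $t\ge0$.
   Context: Let $B=(B_t)_{t\ge 0}$ be a standard Brownian motion started at $0$ on a complete probability space. For $\lambda>0$, $z>0$, put $B^\lambda_t=B_t+\lambda t$, $\sigma_z^\lambda=\sup\{t>0: B^\lambda_t=z\}$ (almost surely finite), and $\xi^{\lambda,z}_t=B^\lambda_{t\wedge\sigma_z^\lambda}$, $t\ge 0$. The semigroup of $\zeta^{\lambda,z}$ (with respect to its completed natural filtration) is: $Q^{\lambda,z}_0$ the identity and, for $t>0$ and $h$ bounded measurable on $\{0,1\}\times\mathbb{R}$, $$Q^{\lambda,z}_th(y_1,y_2)=(1-y_1)h(y_1,y_2)+y_1h(0,z)\Big[\Phi\Big(\lambda\sqrt t-\tfrac{|z-y_2|}{\sqrt t}\Big)-e^{2\lambda|z-y_2|}\Phi\Big(-\lambda\sqrt t-\tfrac{|z-y_2|}{\sqrt t}\Big)\Big]+y_1e^{\lambda\alpha(z,y_2)}\int_{\mathbb{R}}h(1,\eta)e^{-\lambda\alpha(z,\eta)}p(t,\eta-y_2,\lambda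 t)\,\mathrm{d}\eta,$$ where $\Phi$ is the standard normal distribution function, $\alpha(z,x)=|z-x|-(z-x)$, and $p(t,x,y)=\frac{1}{\sqrt{2\pi t}}\exp\big(-\frac{(x-y)^2}{2t}\big)$. $C_0(\{0,1\}\times\mathbb{R})$ is the space of continuous functions on $\{0,1\}\times\mathbb{R}$ vanishing at infinity. *)

theory Defs
  imports "HOL-Probability.Probability"
begin

section \<open>Brownian motion\<close>

text \<open>
  Path regularity and the initial value are only required almost surely; the values of \<open>B\<close> at
  negative times play no role.
\<close>

definition standard_brownian_motion :: "'a measure \<Rightarrow> (real \<Rightarrow> 'a \<Rightarrow> real) \<Rightarrow> bool" where
  "standard_brownian_motion M B \<longleftrightarrow>
     (\<forall>t\<ge>0. B t \<in> borel_measurable M) \<and>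
     (AE \<omega> in M. B 0 \<omega> = 0) \<and>
     (AE \<omega> in M. continuous_on {0..} (\<lambda>t. B t \<omega>)) \<and>
     (\<forall>s t. 0 \<le> s \<longrightarrow> s < t \<longrightarrow>
        distributed M lborel (\<lambda>\<omega>. B t \<omega> - B s \<omega>) (normal_density 0 (sqrt (t - s)))) \<and>
     (\<forall>(n::nat) \<tau>. 0 \<le> \<tau> 0 \<longrightarrow> (\<forall>i<n. \<tau> i \<le> \<tau> (Suc i)) \<longrightarrow>
        prob_space.indep_vars M (\<lambda>_. borel) (\<lambda>i \<omega>. B (\<tau> (Suc i)) \<omega> - B (\<tau> i) \<omega>) {..<n})"


section \<open>Feller processes with values in a subset of a topological space\<close>

text \<open>
  The state space is a set \<open>E\<close> with the subspace topology and its Borel sets. Functions on \<open>E\<close> are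
  represented by functions on the whole type whose values outside \<open>E\<close> are irrelevant.
\<close>

abbreviation borel_on :: "'e::topological_space set \<Rightarrow> 'e measure" where
  "borel_on E \<equiv> restrict_space borel E"

definition bounded_measurable_on :: "'e::topological_space set \<Rightarrow> ('e \<Rightarrow> real) set" where
  "bounded_measurable_on E = {h. h \<in> borel_measurable (borel_on E) \<and> bounded (h ` E)}"

definition C0_on :: "'e::topological_space set \<Rightarrow> ('e \<Rightarrow> real) set" where
  "C0_on E = {h. continuous_on E h \<and>
     (\<forall>\<epsilon>>0. \<exists>K. compact K \<and> K \<subseteq> E \<and> (\<forall>y\<in>E - K. \<bar>h y\<bar> < \<epsilon>))}"

definition markov_semigroup_on ::
  "'e::topological_space set \<Rightarrow> (real \<Rightarrow> ('e \<Rightarrow> real) \<Rightarrow> 'e \<Rightarrow> real) \<Rightarrow> bool" where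
  "markov_semigroup_on E Q \<longleftrightarrow>
     (\<forall>t\<ge>0. \<exists>\<kappa> \<in> borel_on E \<rightarrow>\<^sub>M prob_algebra (borel_on E).
        \<forall>h\<in>bounded_measurable_on E. \<forall>y\<in>E. Q t h y = (\<integral>x. h x \<partial>\<kappa> y)) \<and>
     (\<forall>h\<in>bounded_measurable_on E. \<forall>y\<in>E. Q 0 h y = h y) \<and>
     (\<forall>s\<ge>0. \<forall>t\<ge>0. \<forall>h\<in>bounded_measurable_on E. \<forall>y\<in>E. Q (s + t) h y = Q s (Q t h) y)"

definition completed_natural_filtration ::
  "'a measure \<Rightarrow> 'e::topological_space set \<Rightarrow> (real \<Rightarrow> 'a \<Rightarrow> 'e) \<Rightarrow> real \<Rightarrow> 'a measure" where
  "completed_natural_filtration M E X t = sigma (space M)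
     ({X s -` A \<inter> space M | s A. s \<in> {0..t} \<and> A \<in> sets (borel_on E)} \<union> null_sets M)"

definition markov_process ::
  "'a measure \<Rightarrow> (real \<Rightarrow> 'a measure) \<Rightarrow> 'e::topological_space set \<Rightarrow>
   (real \<Rightarrow> ('e \<Rightarrow> real) \<Rightarrow> 'e \<Rightarrow> real) \<Rightarrow> (real \<Rightarrow> 'a \<Rightarrow> 'e) \<Rightarrow> bool" where
  "markov_process M F E Q X \<longleftrightarrow>
     filtration (space M) F \<and>
     (\<forall>t\<ge>0. subalgebra M (F t)) \<and>
     (\<forall>t\<ge>0. X t \<in> F t \<rightarrow>\<^sub>M borel_on E) \<and>
     markov_semigroup_on E Q \<and>
     (\<forall>s\<ge>0. \<forall>t\<ge>0. \<forall>h\<in>bounded_measurable_on E.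
        AE \<omega> in M. real_cond_exp M (F s) (\<lambda>\<omega>. h (X (s + t) \<omega>)) \<omega> = Q t h (X s \<omega>))"

definition feller_process ::
  "'a measure \<Rightarrow> (real \<Rightarrow> 'a measure) \<Rightarrow> 'e::topological_space set \<Rightarrow>
   (real \<Rightarrow> ('e \<Rightarrow> real) \<Rightarrow> 'e \<Rightarrow> real) \<Rightarrow> (real \<Rightarrow> 'a \<Rightarrow> 'e) \<Rightarrow> bool" where
  "feller_process M F E Q X \<longleftrightarrow>
     markov_process M F E Q X \<and>
     (\<forall>h\<in>C0_on E. \<forall>y\<in>E. ((\<lambda>t. Q t h y) \<longlongrightarrow> h y) (at_right 0)) \<and>
     (\<forall>t\<ge>0. \<forall>h\<in>C0_on E. Q t h \<in> C0_on E)"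


section \<open>The process stopped at its last passage time, and its semigroup\<close>

definition drifted :: "(real \<Rightarrow> 'a \<Rightarrow> real) \<Rightarrow> real \<Rightarrow> real \<Rightarrow> 'a \<Rightarrow> real" where
  "drifted B lam t \<omega> = B t \<omega> + lam * t"

text \<open>
  The supremum is taken in the extended reals, so that it is \<open>\<infinity>\<close> on paths visiting \<open>z\<close> at
  arbitrarily late times and \<open>- \<infinity>\<close> on paths that never visit \<open>z\<close> at a positive time; both
  events are null. In the second case the stopped process below takes the value at time 0
  throughout, as it would under the convention that the empty supremum is 0.
\<close>

definition last_passage :: "(real \<Rightarrow> 'a \<Rightarrow> real) \<Rightarrow> real \<Rightarrow> real \<Rightarrow> 'a \<Rightarrow> ereal" where
  "last_passage B lam z \<omega> = Sup (ereal ` {t. t > 0 \<and> drifted B lam t \<omega> = z})"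

definition xi :: "(real \<Rightarrow> 'a \<Rightarrow> real) \<Rightarrow> real \<Rightarrow> real \<Rightarrow> real \<Rightarrow> 'a \<Rightarrow> real" where
  "xi B lam z t \<omega> = drifted B lam (real_of_ereal (min (ereal t) (last_passage B lam z \<omega>))) \<omega>"

definition zeta :: "(real \<Rightarrow> 'a \<Rightarrow> real) \<Rightarrow> real \<Rightarrow> real \<Rightarrow> real \<Rightarrow> 'a \<Rightarrow> real \<times> real" where
  "zeta B lam z t \<omega> = (if ereal t < last_passage B lam z \<omega> then 1 else 0, xi B lam z t \<omega>)"

definition state_space :: "(real \<times> real) set" where
  "state_space = {0, 1} \<times> UNIV"

definition Phi :: "real \<Rightarrow> real" where
  "Phi = cdf std_normal_distribution"

definition alpha :: "real \<Rightarrow> real \<Rightarrow> real" where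
  "alpha z x = \<bar>z - x\<bar> - (z - x)"

definition gauss_kernel :: "real \<Rightarrow> real \<Rightarrow> real \<Rightarrow> real" where
  "gauss_kernel t x y = 1 / sqrt (2 * pi * t) * exp (- ((x - y)\<^sup>2) / (2 * t))"

definition Q_semigroup ::
  "real \<Rightarrow> real \<Rightarrow> real \<Rightarrow> (real \<times> real \<Rightarrow> real) \<Rightarrow> real \<times> real \<Rightarrow> real" where
  "Q_semigroup lam z t h = (if t = 0 then h else (\<lambda>(y1, y2).
     (1 - y1) * h (y1, y2)
     + y1 * h (0, z) *
         (Phi (lam * sqrt t - \<bar>z - y2\<bar> / sqrt t)
          - exp (2 * lam * \<bar>z - y2\<bar>) * Phi (- lam * sqrt t - \<bar>z - y2\<bar> / sqrt t))
     + y1 * exp (lam * alpha z y2) *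
         (\<integral>\<eta>. h (1, \<eta>) * exp (- lam * alpha z \<eta>) * gauss_kernel t (\<eta> - y2) (lam * t) \<partial>lborel)))"

end

theory Submission
  imports Defs
begin

text \<open>
  For the drifted motion started at \<open>x\<close>, let \<open>g x = exp (- lam * alpha z x)\<close>. Since \<open>g\<close> is the
  probability of ever visiting \<open>z\<close>, conditioning on a visit still to come is Doob's h-transform
  by \<open>g\<close>: with \<open>P\<close> the transition semigroup of the drifted motion, the bracket in the definition of
  \<open>Q\<close> is \<open>1 - P t g / g\<close>, and the semigroup and Feller properties of \<open>Q\<close> reduce to those of \<open>P\<close>.
  The Markov property holds because, before the last passage time, the filtration of the stopped
  process agrees with the past of the drifted motion, given which a later visit to \<open>z\<close> has
  probability \<open>g\<close> of the current position. That last fact follows from the Markov property at times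
  on dyadic grids: the probability of a grid point at or below \<open>z\<close> is at most \<open>g\<close> by induction,
  and, up to the overshoot of a single step, at least \<open>g\<close> times the probability of being
  below \<open>z\<close> at the end under the reversed drift, which tends to 1.
\<close>

section \<open>The transition operators of Brownian motion with drift\<close>

text \<open>The hypotheses give independence only along finitely many fixed times, so the first
  visit to \<open>z\<close> is never handled as a random time; this is why grids appear. A grid
  almost surely misses \<open>z\<close> itself, hence the condition "at or below \<open>z\<close>".
  A path that only touches \<open>z\<close> from above can escape every grid; this gap is closed by
  levels slightly above \<open>z\<close> and the continuity of the visit probability in the level.
  The other obstacle is the division by \<open>g\<close>, which decays exponentially above
  \<open>z\<close>. The function \<open>exp (- 2 * lam * x)\<close> is harmonic for drift
  \<open>lam\<close>, and transforming by it reverses the drift; above \<open>z\<close> the quotient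
  is therefore again a Gaussian average of bounded functions. \<open>g\<close> itself is only
  excessive: the mass missing from \<open>P t g / g\<close> is what gets stopped, and it sits at the
  absorbing point \<open>(0, z)\<close>. Subtracting the value of a test function there leaves only
  paths with a visit still to come.\<close>

definition drift_op :: "real \<Rightarrow> real \<Rightarrow> (real \<Rightarrow> real) \<Rightarrow> real \<Rightarrow> real" where
  "drift_op mu t \<phi> x = (\<integral>w. \<phi> (x + mu * t + sqrt t * w) \<partial>std_normal_distribution)"

interpretation std_normal: prob_space std_normal_distribution
  by (rule prob_space_normal_density) simp

section \<open>Bounded Borel functions\<close>

definition bounded_measurable :: "('b::topological_space \<Rightarrow> real) \<Rightarrow> bool" where
  "bounded_measurable \<phi> \<longleftrightarrow> \<phi> \<in> borel_measurable borel \<and> bounded (range \<phi>)"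

lemma bounded_measurableI:
  assumes "\<phi> \<in> borel_measurable borel" "\<And>x. \<bar>\<phi> x\<bar> \<le> C"
  shows "bounded_measurable \<phi>"
  using assms unfolding bounded_measurable_def bounded_iff by auto

lemma bounded_measurable_measurable [measurable_dest]:
  "bounded_measurable \<phi> \<Longrightarrow> \<phi> \<in> borel_measurable borel"
  by (simp add: bounded_measurable_def)

lemma bounded_measurableE:
  assumes "bounded_measurable \<phi>"
  obtains C where "C \<ge> 0" "\<And>x. \<bar>\<phi> x\<bar> \<le> C"
proof -
  obtain C where "\<And>x. \<bar>\<phi> x\<bar> \<le> C"
    using assms unfolding bounded_measurable_def bounded_iff by auto
  then show thesis
    using that[of C] abs_ge_zero order_trans by blast
qed

lemma bounded_measurable_const: "bounded_measurable (\<lambda>_. c)"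
  by (rule bounded_measurableI[where C="\<bar>c\<bar>"]) auto

lemma bounded_measurable_mult:
  assumes "bounded_measurable \<phi>" "bounded_measurable \<psi>"
  shows "bounded_measurable (\<lambda>x. \<phi> x * \<psi> x)"
proof -
  obtain C D where "C \<ge> 0" "\<And>x. \<bar>\<phi> x\<bar> \<le> C" "D \<ge> 0" "\<And>x. \<bar>\<psi> x\<bar> \<le> D"
    using assms by (metis bounded_measurableE)
  then show ?thesis
    using assms by (intro bounded_measurableI[where C="C * D"]) (auto simp: abs_mult intro!: mult_mono)
qed

lemma bounded_measurable_add:
  assumes "bounded_measurable \<phi>" "bounded_measurable \<psi>"
  shows "bounded_measurable (\<lambda>x. \<phi> x + \<psi> x)"
proof -
  obtain C D where "C \<ge> 0" "\<And>x. \<bar>\<phi> x\<bar> \<le> C" "D \<ge> 0" "\<And>x. \<bar>\<psi> x\<bar> \<le> D"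
    using assms by (metis bounded_measurableE)
  then show ?thesis
    using assms by (intro bounded_measurableI[where C="C + D"])
      (auto intro!: order_trans[OF abs_triangle_ineq] add_mono)
qed

lemma bounded_measurable_indicator:
  "A \<in> sets borel \<Longrightarrow> bounded_measurable (indicator A)"
  by (rule bounded_measurableI[where C=1]) (auto simp: indicator_def)

lemma (in prob_space) integrable_bounded_measurable:
  assumes "bounded_measurable \<phi>" "Y \<in> borel_measurable M"
  shows "integrable M (\<lambda>\<omega>. \<phi> (Y \<omega>))"
proof -
  obtain C where "\<And>x. \<bar>\<phi> x\<bar> \<le> C"
    using assms(1) by (metis bounded_measurableE)
  then show ?thesis
    using measurable_compose[OF assms(2) bounded_measurable_measurable[OF assms(1)]]
    by (intro integrable_const_bound[where B=C]) auto
qed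

section \<open>Algebra, densities and composition of the transition operators\<close>

lemma drift_op_integrable:
  "bounded_measurable \<phi> \<Longrightarrow>
    integrable std_normal_distribution (\<lambda>w. \<phi> (x + mu * t + sqrt t * w))"
  by (rule std_normal.integrable_bounded_measurable) simp_all

lemma drift_op_0 [simp]: "drift_op mu 0 \<phi> x = \<phi> x"
  by (simp add: drift_op_def std_normal.prob_space[simplified])

lemma drift_op_const [simp]: "drift_op mu t (\<lambda>_. c) x = c"
  by (simp add: drift_op_def std_normal.prob_space[simplified])

lemma drift_op_add:
  assumes "bounded_measurable \<phi>" "bounded_measurable \<psi>"
  shows "drift_op mu t (\<lambda>x. \<phi> x + \<psi> x) x = drift_op mu t \<phi> x + drift_op mu t \<psi> x"
  unfolding drift_op_def using assms by (intro Bochner_Integration.integral_add drift_op_integrable)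

lemma drift_op_cmult: "drift_op mu t (\<lambda>x. c * \<phi> x) x = c * drift_op mu t \<phi> x"
  unfolding drift_op_def by simp

lemma drift_op_mono:
  assumes "bounded_measurable \<phi>" "bounded_measurable \<psi>" "\<And>x. \<phi> x \<le> \<psi> x"
  shows "drift_op mu t \<phi> x \<le> drift_op mu t \<psi> x"
  unfolding drift_op_def using assms by (intro integral_mono drift_op_integrable) auto

lemma drift_op_abs_le:
  assumes "bounded_measurable \<phi>" "\<And>x. \<bar>\<phi> x\<bar> \<le> C"
  shows "\<bar>drift_op mu t \<phi> x\<bar> \<le> C"
proof -
  have "- C \<le> \<phi> y" "\<phi> y \<le> C" for y
    using assms(2)[of y] by linarith+
  then have "drift_op mu t \<phi> x \<le> drift_op mu t (\<lambda>_. C) x" "drift_op mu t (\<lambda>_. - C) x \<le> drift_op mu t \<phi> x"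
    by (intro drift_op_mono bounded_measurable_const assms(1); simp)+
  then show ?thesis by simp
qed

lemma drift_op_measurable [measurable]:
  assumes [measurable]: "\<phi> \<in> borel_measurable borel"
  shows "drift_op mu t \<phi> \<in> borel_measurable borel"
  unfolding drift_op_def by measurable

lemma bounded_measurable_drift_op:
  assumes "bounded_measurable \<phi>"
  shows "bounded_measurable (drift_op mu t \<phi>)"
proof -
  obtain C where "\<And>x. \<bar>\<phi> x\<bar> \<le> C" using assms by (metis bounded_measurableE)
  then show ?thesis
    using assms by (intro bounded_measurableI[where C=C] drift_op_abs_le) (auto simp: bounded_measurable_measurable)
qed

text \<open>Substitution of \<open>\<eta> = x + mu * t + sqrt t * w\<close>, whose Jacobian
  \<open>sqrt t\<close> relates the standard density to that of variance \<open>t\<close>.\<close>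

lemma drift_op_density:
  assumes [measurable]: "\<phi> \<in> borel_measurable borel" and t: "t > 0"
  shows "drift_op mu t \<phi> x = (\<integral>\<eta>. \<phi> \<eta> * normal_density (mu * t) (sqrt t) (\<eta> - x) \<partial>lborel)"
proof -
  have *: "sqrt t * normal_density (mu * t) (sqrt t) (mu * t + sqrt t * w) = std_normal_density w" for w
    using t by (simp add: normal_density_def real_sqrt_mult power_mult_distrib)
  have "(\<integral>\<eta>. \<phi> \<eta> * normal_density (mu * t) (sqrt t) (\<eta> - x) \<partial>lborel) =
      (\<integral>w. sqrt t * (\<phi> (x + mu * t + sqrt t * w) *
        normal_density (mu * t) (sqrt t) (mu * t + sqrt t * w)) \<partial>lborel)"
    using t by (subst lborel_integral_real_affine[of "sqrt t" _ "x + mu * t"]) (auto simp: algebra_simps)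
  also have "\<dots> = (\<integral>w. std_normal_density w * \<phi> (x + mu * t + sqrt t * w) \<partial>lborel)"
    unfolding *[symmetric] by (simp add: mult_ac)
  also have "\<dots> = drift_op mu t \<phi> x"
    unfolding drift_op_def by (subst integral_density) auto
  finally show ?thesis ..
qed

text \<open>The bridge to random variables. It serves twice: for the semigroup law, with
  \<open>Y\<close> a sum of two independent normal variables, and for the Markov property, with
  \<open>Y\<close> a Brownian increment.\<close>

lemma drift_op_distributed:
  assumes [measurable]: "\<phi> \<in> borel_measurable borel" and t: "t > 0"
    and D: "distributed N lborel Y (normal_density 0 (sqrt t))"
  shows "(\<integral>\<omega>. \<phi> (x + mu * t + Y \<omega>) \<partial>N) = drift_op mu t \<phi> x"
proof -
  have *: "normal_density 0 (sqrt t) (\<eta> - mu * t - x) = normal_density (mu * t) (sqrt t) (\<eta> - x)" for \<eta>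
    by (simp add: normal_density_def algebra_simps)
  have "(\<integral>\<omega>. \<phi> (x + mu * t + Y \<omega>) \<partial>N) =
      (\<integral>y. normal_density 0 (sqrt t) y * \<phi> (x + mu * t + y) \<partial>lborel)"
    by (rule distributed_integral[OF D, symmetric]) auto
  also have "\<dots> = (\<integral>\<eta>. normal_density 0 (sqrt t) (\<eta> - mu * t - x) * \<phi> \<eta> \<partial>lborel)"
    by (subst lborel_integral_real_affine[of 1 _ "- x - mu * t"]) (auto simp: algebra_simps)
  also have "\<dots> = drift_op mu t \<phi> x"
    unfolding * using t by (subst drift_op_density) (auto simp: mult.commute)
  finally show ?thesis .
qed

text \<open>Completing the square shows that the two integrands agree pointwise. With \<phi>
  constant this is harmonicity of the exponential; in general it says that transforming by the
  exponential reverses the drift.\<close>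

lemma drift_op_tilt:
  assumes [measurable]: "\<phi> \<in> borel_measurable borel" and t: "t \<ge> 0"
  shows "drift_op mu t (\<lambda>\<eta>. exp (- 2 * mu * \<eta>) * \<phi> \<eta>) x = exp (- 2 * mu * x) * drift_op (- mu) t \<phi> x"
proof (cases "t = 0")
  case False
  with t have t: "t > 0" by simp
  have "- ((\<eta> - x - mu * t)\<^sup>2) / (2 * t) - 2 * mu * \<eta> = - 2 * mu * x - ((\<eta> - x + mu * t)\<^sup>2) / (2 * t)" for \<eta>
    using t by (simp add: field_simps power2_eq_square)
  then have "exp (- 2 * mu * \<eta>) * normal_density (mu * t) (sqrt t) (\<eta> - x) =
      exp (- 2 * mu * x) * normal_density (- mu * t) (sqrt t) (\<eta> - x)" for \<eta>
    using t by (simp add: normal_density_def flip: exp_add) (smt (verit, best))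
  then have *: "exp (- 2 * mu * \<eta>) * \<phi> \<eta> * normal_density (mu * t) (sqrt t) (\<eta> - x) =
      exp (- 2 * mu * x) * (\<phi> \<eta> * normal_density (- mu * t) (sqrt t) (\<eta> - x))" for \<eta>
    by (metis mult.assoc mult.commute)
  have "drift_op mu t (\<lambda>\<eta>. exp (- 2 * mu * \<eta>) * \<phi> \<eta>) x =
      (\<integral>\<eta>. exp (- 2 * mu * x) * (\<phi> \<eta> * normal_density (- mu * t) (sqrt t) (\<eta> - x)) \<partial>lborel)"
    unfolding *[symmetric] using t by (intro drift_op_density) auto
  then show ?thesis
    using t by (simp add: drift_op_density del: mult_minus_left)
qed simp

lemma (in pair_prob_space) distr_snd: "distr (M1 \<Otimes>\<^sub>M M2) M2 snd = M2"
proof (rule measure_eqI)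
  fix A assume "A \<in> sets (distr (M1 \<Otimes>\<^sub>M M2) M2 snd)"
  then have A: "A \<in> sets M2" by simp
  then have "snd -` A \<inter> space (M1 \<Otimes>\<^sub>M M2) = space M1 \<times> A"
    using sets.sets_into_space[OF A] by (auto simp: space_pair_measure)
  with A show "emeasure (distr (M1 \<Otimes>\<^sub>M M2) M2 snd) A = emeasure M2 A"
    by (simp add: emeasure_distr M2.emeasure_pair_measure_Times M1.emeasure_space_1)
qed simp

text \<open>On the product of two standard normal laws the scaled coordinates are independent with
  variances \<open>s\<close> and \<open>t\<close>, so their sum has variance \<open>s + t\<close>.
  Fubini then integrates out one coordinate after the other. Zero times are split off because the
  normal laws must be nondegenerate.\<close>

lemma drift_op_semigroup:
  assumes \<phi>: "bounded_measurable \<phi>" and s: "s \<ge> 0" and t: "t \<ge> 0"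
  shows "drift_op mu s (drift_op mu t \<phi>) x = drift_op mu (s + t) \<phi> x"
proof (cases "s = 0 \<or> t = 0")
  case True
  moreover have "drift_op mu 0 \<psi> = \<psi>" for \<psi>
    by auto
  ultimately show ?thesis
    by auto
next
  case False
  with s t have s: "s > 0" and t: "t > 0" by auto
  note [measurable] = bounded_measurable_measurable[OF \<phi>]
  let ?N = std_normal_distribution
  interpret NN: pair_prob_space ?N ?N ..
  have D: "distributed (?N \<Otimes>\<^sub>M ?N) lborel (\<lambda>p. sqrt r * q p) (normal_density 0 (sqrt r))"
    if "r > 0" "distributed (?N \<Otimes>\<^sub>M ?N) lborel q std_normal_density" for r q
    using NN.normal_density_affine[OF that(2), of "sqrt r" 0] that(1) by simp
  have distr_lborel: "distr (?N \<Otimes>\<^sub>M ?N) lborel f = distr (?N \<Otimes>\<^sub>M ?N) ?N f" for f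
    by (intro distr_cong) auto
  have Dfst: "distributed (?N \<Otimes>\<^sub>M ?N) lborel fst std_normal_density"
    and Dsnd: "distributed (?N \<Otimes>\<^sub>M ?N) lborel snd std_normal_density"
    by (auto simp: distributed_def distr_lborel NN.distr_snd std_normal.distr_pair_fst)
  have "NN.indep_var ?N fst ?N snd"
    by (subst NN.indep_var_distribution_eq) (simp add: NN.distr_snd std_normal.distr_pair_fst distr_id2)
  then have I: "NN.indep_var borel fst borel snd"
    unfolding NN.indep_var_eq by (simp cong: measurable_cong_sets)
  have I: "NN.indep_var borel (\<lambda>p. sqrt s * fst p) borel (\<lambda>p. sqrt t * snd p)"
    using NN.indep_var_compose[OF I, of "\<lambda>x. sqrt s * x" borel "\<lambda>x. sqrt t * x" borel]
    by (simp add: comp_def)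
  have *: "distributed (?N \<Otimes>\<^sub>M ?N) lborel (\<lambda>p. sqrt s * fst p + sqrt t * snd p) (normal_density 0 (sqrt (s + t)))"
    using NN.add_indep_normal[OF I _ _ D[OF s Dfst] D[OF t Dsnd]] s t by simp
  have "drift_op mu (s + t) \<phi> x = (\<integral>p. \<phi> (x + mu * (s + t) + (sqrt s * fst p + sqrt t * snd p)) \<partial>(?N \<Otimes>\<^sub>M ?N))"
    by (rule drift_op_distributed[OF _ _ *, symmetric]) (use s t in auto)
  also have "\<dots> = (\<integral>w. (\<integral>v. \<phi> (x + mu * (s + t) + (sqrt s * w + sqrt t * v)) \<partial>?N) \<partial>?N)"
    by (subst NN.integral_fst'[symmetric]) (auto intro!: NN.integrable_bounded_measurable[OF \<phi>])
  also have "\<dots> = drift_op mu s (drift_op mu t \<phi>) x"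
    unfolding drift_op_def by (simp add: algebra_simps)
  finally show ?thesis ..
qed

text \<open>The reference measure depends on neither the starting point nor the time. One use of
  dominated convergence therefore covers continuity in \<open>x\<close>, the limit at time 0, the
  limits at both ends of the line and those for large times.\<close>

lemma drift_op_LIMSEQ:
  assumes \<phi>: "\<And>n. \<phi> n \<in> borel_measurable borel" "\<And>n x. \<bar>\<phi> n x\<bar> \<le> C"
    and lim: "\<And>w. (\<lambda>n. \<phi> n (X n + mu * T n + sqrt (T n) * w)) \<longlonglongrightarrow> l w"
  shows "(\<lambda>n. drift_op mu (T n) (\<phi> n) (X n)) \<longlonglongrightarrow> (\<integral>w. l w \<partial>std_normal_distribution)"
  unfolding drift_op_def
proof (rule integral_dominated_convergence[where w="\<lambda>_. C"])
  note [measurable] = \<phi>(1)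
  show "(\<lambda>w. \<phi> n (X n + mu * T n + sqrt (T n) * w)) \<in> borel_measurable std_normal_distribution" for n
    by measurable
  show "l \<in> borel_measurable std_normal_distribution"
    using lim by (rule borel_measurable_LIMSEQ_real) measurable
qed (use \<phi> lim in auto)

lemma drift_op_LIMSEQ_const:
  assumes "\<And>n. \<phi> n \<in> borel_measurable borel" "\<And>n x. \<bar>\<phi> n x\<bar> \<le> C"
    and "\<And>w. (\<lambda>n. \<phi> n (X n + mu * T n + sqrt (T n) * w)) \<longlonglongrightarrow> l"
  shows "(\<lambda>n. drift_op mu (T n) (\<phi> n) (X n)) \<longlonglongrightarrow> l"
  using drift_op_LIMSEQ[where l="\<lambda>_. l", OF assms] by (simp add: std_normal.prob_space[simplified])

lemma drift_op_tendsto_at_top: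
  assumes \<phi>: "bounded_measurable \<phi>" and lim: "(\<phi> \<longlongrightarrow> l) at_top"
  shows "(drift_op mu t \<phi> \<longlongrightarrow> l) at_top"
proof (rule tendsto_at_topI_sequentially)
  fix X :: "nat \<Rightarrow> real" assume X: "filterlim X at_top sequentially"
  obtain C where C: "\<And>x. \<bar>\<phi> x\<bar> \<le> C" using \<phi> by (metis bounded_measurableE)
  have "filterlim (\<lambda>n. (mu * t + sqrt t * w) + X n) at_top sequentially" for w
    using X by (intro filterlim_tendsto_add_at_top[OF tendsto_const])
  then have "(\<lambda>n. \<phi> (X n + mu * t + sqrt t * w)) \<longlonglongrightarrow> l" for w
    using filterlim_compose[OF lim, of "\<lambda>n. X n + mu * t + sqrt t * w" sequentially] by (simp add: algebra_simps)
  then show "(\<lambda>n. drift_op mu t \<phi> (X n)) \<longlonglongrightarrow> l"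
    using \<phi> C by (intro drift_op_LIMSEQ_const) (auto simp: bounded_measurable_measurable)
qed

lemma drift_op_tendsto_at_bot:
  assumes \<phi>: "bounded_measurable \<phi>" and lim: "(\<phi> \<longlongrightarrow> l) at_bot"
  shows "(drift_op mu t \<phi> \<longlongrightarrow> l) at_bot"
proof (rule tendsto_at_botI_sequentially)
  fix X :: "nat \<Rightarrow> real" assume X: "filterlim X at_bot sequentially"
  obtain C where C: "\<And>x. \<bar>\<phi> x\<bar> \<le> C" using \<phi> by (metis bounded_measurableE)
  have "filterlim (\<lambda>n. X n + (mu * t + sqrt t * w)) at_bot sequentially" for w
    using X unfolding filterlim_at_bot
    by (intro allI) (use X[unfolded filterlim_at_bot] in \<open>simp add: le_diff_eq[symmetric]\<close>)
  then have "(\<lambda>n. \<phi> (X n + mu * t + sqrt t * w)) \<longlonglongrightarrow> l" for w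
    using filterlim_compose[OF lim, of "\<lambda>n. X n + mu * t + sqrt t * w" sequentially] by (simp add: algebra_simps)
  then show "(\<lambda>n. drift_op mu t \<phi> (X n)) \<longlonglongrightarrow> l"
    using \<phi> C by (intro drift_op_LIMSEQ_const) (auto simp: bounded_measurable_measurable)
qed

lemma continuous_on_drift_op:
  assumes \<phi>: "bounded_measurable \<phi>" "continuous_on UNIV \<phi>"
  shows "continuous_on UNIV (drift_op mu t \<phi>)"
  unfolding continuous_on_sequentially comp_def
proof (intro allI ballI impI, elim conjE)
  fix X :: "nat \<Rightarrow> real" and x assume X: "X \<longlonglongrightarrow> x"
  obtain C where C: "\<And>x. \<bar>\<phi> x\<bar> \<le> C" using \<phi> by (metis bounded_measurableE)
  have "(\<lambda>n. \<phi> (X n + mu * t + sqrt t * w)) \<longlonglongrightarrow> \<phi> (x + mu * t + sqrt t * w)" for w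
    by (intro continuous_on_tendsto_compose[OF \<phi>(2)] tendsto_intros X) auto
  then show "(\<lambda>n. drift_op mu t \<phi> (X n)) \<longlonglongrightarrow> drift_op mu t \<phi> x"
    using \<phi> C unfolding drift_op_def[of mu t \<phi> x]
    by (intro drift_op_LIMSEQ) (auto simp: bounded_measurable_measurable)
qed

lemma drift_op_tendsto_0:
  assumes \<phi>: "bounded_measurable \<phi>" "continuous_on UNIV \<phi>"
  shows "((\<lambda>t. drift_op mu t \<phi> x) \<longlongrightarrow> \<phi> x) (at_right 0)"
  unfolding tendsto_at_iff_sequentially comp_def
proof (intro allI impI)
  fix X :: "nat \<Rightarrow> real" assume X: "X \<longlonglongrightarrow> 0"
  obtain C where C: "\<And>x. \<bar>\<phi> x\<bar> \<le> C" using \<phi> by (metis bounded_measurableE)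
  have "(\<lambda>n. \<phi> (x + mu * X n + sqrt (X n) * w)) \<longlonglongrightarrow> \<phi> (x + mu * 0 + sqrt 0 * w)" for w
    by (intro continuous_on_tendsto_compose[OF \<phi>(2)] tendsto_intros X) auto
  then show "(\<lambda>n. drift_op mu (X n) \<phi> x) \<longlonglongrightarrow> \<phi> x"
    using \<phi> C by (intro drift_op_LIMSEQ_const) (auto simp: bounded_measurable_measurable)
qed

section \<open>The semigroup as an h-transform\<close>

definition visit_prob :: "real \<Rightarrow> real \<Rightarrow> real \<Rightarrow> real" where
  "visit_prob lam z x = exp (- lam * alpha z x)"

text \<open>The probability of visiting \<open>z\<close> under drift \<open>- lam\<close>: the
  exponential factor moves the decay of \<open>visit_prob\<close> from above \<open>z\<close> to
  below it.\<close>

definition visit_prob_dual :: "real \<Rightarrow> real \<Rightarrow> real \<Rightarrow> real" where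
  "visit_prob_dual lam z x = exp (2 * lam * (x - z)) * visit_prob lam z x"

lemma visit_prob_eq: "visit_prob lam z x = (if x \<le> z then 1 else exp (- 2 * lam * (x - z)))"
  by (auto simp: visit_prob_def alpha_def algebra_simps)

lemma visit_prob_dual_eq: "visit_prob_dual lam z x = (if x \<le> z then exp (2 * lam * (x - z)) else 1)"
  by (auto simp: visit_prob_dual_def visit_prob_eq algebra_simps simp flip: exp_add)

lemma visit_prob_pos [simp]: "visit_prob lam z x > 0"
  by (simp add: visit_prob_def)

lemma visit_prob_dual_pos [simp]: "visit_prob_dual lam z x > 0"
  by (simp add: visit_prob_dual_def)

lemma visit_prob_nonzero [simp]: "visit_prob lam z x \<noteq> 0"
  using visit_prob_pos[of lam z x] by linarith

lemma visit_prob_le_1: "lam > 0 \<Longrightarrow> visit_prob lam z x \<le> 1"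
  and visit_prob_dual_le_1: "lam > 0 \<Longrightarrow> visit_prob_dual lam z x \<le> 1"
  by (auto simp: visit_prob_eq visit_prob_dual_eq mult_nonneg_nonpos mult_nonneg_nonneg)

lemma continuous_on_visit_prob: "continuous_on UNIV (visit_prob lam z)"
  unfolding visit_prob_def alpha_def by (intro continuous_intros)

lemma continuous_on_visit_prob_dual: "continuous_on UNIV (visit_prob_dual lam z)"
  unfolding visit_prob_dual_def
  by (intro continuous_intros continuous_on_subset[OF continuous_on_visit_prob]) simp

lemma bounded_measurable_visit_prob: "lam > 0 \<Longrightarrow> bounded_measurable (visit_prob lam z)"
  by (intro bounded_measurableI[where C=1] borel_measurable_continuous_onI continuous_on_visit_prob)
     (simp add: visit_prob_le_1 less_imp_le)

lemma bounded_measurable_visit_prob_dual: "lam > 0 \<Longrightarrow> bounded_measurable (visit_prob_dual lam z)"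
  by (intro bounded_measurableI[where C=1] borel_measurable_continuous_onI continuous_on_visit_prob_dual)
     (simp add: visit_prob_dual_le_1 less_imp_le)

lemma visit_prob_at_bot: "(visit_prob lam z \<longlongrightarrow> 1) at_bot"
  by (rule tendsto_eventually, rule eventually_mono[OF eventually_le_at_bot[of z]]) (simp add: visit_prob_eq)

lemma visit_prob_dual_at_top: "(visit_prob_dual lam z \<longlongrightarrow> 1) at_top"
  by (rule tendsto_eventually, rule eventually_mono[OF eventually_gt_at_top[of z]]) (simp add: visit_prob_dual_eq)

text \<open>The Cameron-Martin change of drift turns the unbounded factor of the h-transform above the
  level into a bounded one.\<close>

lemma drift_op_visit_prob_dual:
  assumes [measurable]: "\<phi> \<in> borel_measurable borel" and t: "t \<ge> 0"
  shows "drift_op lam t (\<lambda>\<eta>. \<phi> \<eta> * visit_prob lam z \<eta>) x =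
    exp (- 2 * lam * (x - z)) * drift_op (- lam) t (\<lambda>\<eta>. \<phi> \<eta> * visit_prob_dual lam z \<eta>) x"
proof -
  have [measurable]: "visit_prob_dual lam z \<in> borel_measurable borel"
    by (intro borel_measurable_continuous_onI continuous_on_visit_prob_dual)
  have "\<phi> \<eta> * visit_prob lam z \<eta> =
      exp (- 2 * lam * \<eta>) * (exp (2 * lam * z) * (\<phi> \<eta> * visit_prob_dual lam z \<eta>))" for \<eta>
    by (simp add: visit_prob_dual_def mult_ac right_diff_distrib flip: exp_add)
  then have "drift_op lam t (\<lambda>\<eta>. \<phi> \<eta> * visit_prob lam z \<eta>) x =
      exp (- 2 * lam * x) * drift_op (- lam) t (\<lambda>\<eta>. exp (2 * lam * z) * (\<phi> \<eta> * visit_prob_dual lam z \<eta>)) x"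
    using t by (simp only:) (rule drift_op_tilt; measurable)
  moreover have "exp (- 2 * lam * (x - z)) = exp (- 2 * lam * x) * exp (2 * lam * z)"
    by (simp add: algebra_simps flip: exp_add)
  ultimately show ?thesis
    by (simp only: drift_op_cmult mult.assoc)
qed

text \<open>Below \<open>z\<close> the denominator is 1; above \<open>z\<close> it cancels the
  exponential produced by the change of drift. The choice depends on the starting point
  \<open>x\<close> alone, so for each \<open>x\<close> the quotient is one transition operator
  applied to a bounded weight.\<close>

lemma h_transform_eq:
  assumes "\<phi> \<in> borel_measurable borel" and "t \<ge> 0"
  shows "drift_op lam t (\<lambda>\<eta>. \<phi> \<eta> * visit_prob lam z \<eta>) x / visit_prob lam z x =
    drift_op (if x \<le> z then lam else - lam) t
      (\<lambda>\<eta>. \<phi> \<eta> * (if x \<le> z then visit_prob lam z \<eta> else visit_prob_dual lam z \<eta>)) x"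
  using drift_op_visit_prob_dual[OF assms, of lam z x] by (simp add: visit_prob_eq[of lam z x])

section \<open>The bracket in closed form\<close>

lemma Phi_uminus: "Phi (- a) = 1 - Phi a"
proof -
  have Phi: "Phi b = (\<integral>w. std_normal_density w * indicator {..b} w \<partial>lborel)" for b
  proof -
    have "Phi b = (\<integral>w. indicator {..b} w \<partial>std_normal_distribution)"
      by (simp add: Phi_def cdf_def)
    also have "\<dots> = (\<integral>w. std_normal_density w * indicator {..b} w \<partial>lborel)"
      by (subst integral_density) auto
    finally show ?thesis .
  qed
  have int: "integrable lborel (\<lambda>w. std_normal_density w * indicator A w)" if "A \<in> sets borel" for A
    using that by (intro integrable_real_mult_indicator) auto
  have "Phi (- a) = (\<integral>w. std_normal_density w * indicator {a..} w \<partial>lborel)"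
    unfolding Phi
    by (subst lborel_integral_real_affine[of "-1" _ 0])
       (auto intro!: Bochner_Integration.integral_cong simp: normal_density_def indicator_def)
  then have "Phi (- a) + Phi a = (\<integral>w. std_normal_density w * indicator {a..} w + std_normal_density w * indicator {..a} w \<partial>lborel)"
    unfolding Phi by (subst Bochner_Integration.integral_add) (auto intro!: int)
  \<comment> \<open>The two half-lines overlap only in the null set \<open>{a}\<close>.\<close>
  also have "\<dots> = (\<integral>w. std_normal_density w \<partial>lborel)"
    by (rule integral_cong_AE, measurable, rule AE_I'[of "{a}"]) (auto simp: indicator_def)
  also have "\<dots> = 1" by simp
  finally show ?thesis by simp
qed

lemma drift_op_atMost:
  assumes "t > 0"
  shows "drift_op mu t (indicator {..z}) x = Phi ((z - x) / sqrt t - mu * sqrt t)"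
proof -
  have "indicator {..z} (x + mu * t + sqrt t * w) = (indicator {..(z - x) / sqrt t - mu * sqrt t} w :: real)" for w
    using assms by (auto simp: indicator_def field_simps)
  then show ?thesis
    by (simp add: drift_op_def Phi_def cdf_def)
qed

lemma drift_op_greaterThan:
  assumes "t > 0"
  shows "drift_op mu t (indicator {z<..}) x = Phi ((x - z) / sqrt t + mu * sqrt t)"
proof -
  have *: "indicator {z<..} = (\<lambda>\<eta>. 1 + (- 1) * indicator {..z} \<eta> :: real)"
    by (auto simp: indicator_def)
  have "drift_op mu t (indicator {z<..}) x = 1 - Phi ((z - x) / sqrt t - mu * sqrt t)"
    unfolding * using assms
    by (simp only: drift_op_add drift_op_cmult drift_op_const drift_op_atMost bounded_measurable_const
        bounded_measurable_mult bounded_measurable_indicator atMost_borel)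
  also have "\<dots> = Phi (- ((z - x) / sqrt t - mu * sqrt t))"
    by (rule Phi_uminus[symmetric])
  finally show ?thesis
    by (simp add: diff_divide_distrib algebra_simps)
qed

text \<open>The bracket is the conditional probability that the last visit happens before time t: one
  minus the ratio of the probabilities of a visit after time t and of a visit at all.\<close>

lemma bracket_eq:
  assumes t: "t > 0" and lam: "lam > 0"
  shows "Phi (lam * sqrt t - \<bar>z - x\<bar> / sqrt t)
      - exp (2 * lam * \<bar>z - x\<bar>) * Phi (- lam * sqrt t - \<bar>z - x\<bar> / sqrt t) =
    1 - drift_op lam t (visit_prob lam z) x / visit_prob lam z x"
proof -
  \<comment> \<open>Above \<open>z\<close> the visit probability is a pure exponential, which the
    change of drift converts into a Gaussian tail under drift \<open>- lam\<close>; below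
    \<open>z\<close> a tail under drift \<open>lam\<close> remains.\<close>
  have split: "visit_prob lam z = (\<lambda>\<eta>. indicator {..z} \<eta> + (indicator {z<..} \<eta> * visit_prob lam z \<eta>))"
    by (auto simp: indicator_def visit_prob_eq)
  have dual: "(\<lambda>\<eta>. indicator {z<..} \<eta> * visit_prob_dual lam z \<eta>) = indicator {z<..}"
    by (auto simp: indicator_def visit_prob_dual_eq)
  \<comment> \<open>The absolute value in the bracket makes \<open>a\<close> and \<open>b\<close>
    exchange roles as \<open>x\<close> crosses \<open>z\<close>.\<close>
  define a where "a = (z - x) / sqrt t - lam * sqrt t"
  define b where "b = (x - z) / sqrt t - lam * sqrt t"
  define e where "e = exp (- 2 * lam * (x - z))"
  have P: "drift_op lam t (visit_prob lam z) x = Phi a + e * Phi b"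
    using t lam unfolding a_def b_def e_def
    by (subst split, subst drift_op_add) (simp_all add: bounded_measurable_indicator
        bounded_measurable_mult bounded_measurable_visit_prob drift_op_visit_prob_dual dual drift_op_atMost drift_op_greaterThan)
  have *: "Phi (lam * sqrt t - (z - x) / sqrt t) = 1 - Phi a" "Phi (lam * sqrt t - (x - z) / sqrt t) = 1 - Phi b"
    unfolding a_def b_def Phi_uminus[symmetric] by simp_all
  have **: "- lam * sqrt t - (z - x) / sqrt t = b" "- lam * sqrt t - (x - z) / sqrt t = a"
    by (simp_all add: a_def b_def diff_divide_distrib)
  have e: "exp (2 * lam * (z - x)) = e" "exp (2 * lam * (x - z)) = 1 / e"
    by (simp_all add: e_def exp_minus[symmetric] inverse_eq_divide[symmetric] right_diff_distrib)
  show ?thesis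
  proof (cases "x \<le> z")
    case True
    then have abs: "\<bar>z - x\<bar> = z - x" and g: "visit_prob lam z x = 1"
      by (simp_all add: visit_prob_eq)
    show ?thesis
      unfolding abs P * ** e g by simp
  next
    case False
    then have abs: "\<bar>z - x\<bar> = x - z" and g: "visit_prob lam z x = e"
      by (simp_all add: visit_prob_eq e_def)
    have "e \<noteq> 0"
      by (simp add: e_def)
    then show ?thesis
      unfolding abs P * ** e g by (simp add: field_simps)
  qed
qed

lemma Q_semigroup_0: "Q_semigroup lam z t h (0, x) = h (0, x)"
  by (simp add: Q_semigroup_def)

text \<open>Survivors move by the h-transform, and the lost mass is placed at \<open>(0, z)\<close>.
  The formula also holds at time 0, where \<open>Q_semigroup\<close> is defined separately, so later
  arguments need no case distinction.\<close>

lemma Q_semigroup_1: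
  assumes [measurable]: "(\<lambda>\<eta>. h (1, \<eta>)) \<in> borel_measurable borel" and t: "t \<ge> 0" and lam: "lam > 0"
  shows "Q_semigroup lam z t h (1, x) =
    h (0, z) * (1 - drift_op lam t (visit_prob lam z) x / visit_prob lam z x) +
    drift_op lam t (\<lambda>\<eta>. h (1, \<eta>) * visit_prob lam z \<eta>) x / visit_prob lam z x"
proof (cases "t = 0")
  case True
  then show ?thesis by (simp add: Q_semigroup_def)
next
  case False
  with t have t: "t > 0" by simp
  note [measurable] = bounded_measurable_measurable[OF bounded_measurable_visit_prob[OF lam]]
  have "gauss_kernel t (\<eta> - x) (lam * t) = normal_density (lam * t) (sqrt t) (\<eta> - x)" for \<eta>
    using t by (simp add: gauss_kernel_def normal_density_def)
  then have int: "(\<integral>\<eta>. h (1, \<eta>) * exp (- lam * alpha z \<eta>) * gauss_kernel t (\<eta> - x) (lam * t) \<partial>lborel) =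
      drift_op lam t (\<lambda>\<eta>. h (1, \<eta>) * visit_prob lam z \<eta>) x"
    using t unfolding visit_prob_def[symmetric] by (subst drift_op_density) auto
  have e: "exp (lam * alpha z x) = 1 / visit_prob lam z x"
    by (simp add: visit_prob_def exp_minus field_simps)
  show ?thesis
    unfolding Q_semigroup_def if_not_P[OF less_imp_neq[OF t, symmetric]] prod.case int bracket_eq[OF t lam] e
    by simp
qed

section \<open>Semigroup law and transition kernels on the state space\<close>

lemma borel_on_section:
  assumes "h \<in> borel_measurable (borel_on state_space)" and "i = 0 \<or> i = 1"
  shows "(\<lambda>\<eta>. h (i, \<eta>)) \<in> borel_measurable borel"
proof (rule measurable_compose[OF _ assms(1)])
  show "Pair i \<in> borel \<rightarrow>\<^sub>M borel_on state_space"
    using assms(2) by (intro measurable_restrict_space2) (auto simp: state_space_def)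
qed

lemma bounded_measurable_section:
  assumes "h \<in> bounded_measurable_on state_space" and "i = 0 \<or> i = 1"
  shows "bounded_measurable (\<lambda>\<eta>. h (i, \<eta>))"
proof -
  have "range (\<lambda>\<eta>. h (i, \<eta>)) \<subseteq> h ` state_space"
    using assms(2) by (auto simp: state_space_def)
  then show ?thesis
    using assms borel_on_section[of h i] bounded_subset[of "h ` state_space"]
    by (auto simp: bounded_measurable_on_def bounded_measurable_def)
qed

text \<open>Multiplication by \<open>?g\<close> removes the denominators, so the semigroup law of
  \<open>?P\<close> applies. Mass stopped during the first \<open>s\<close> and during the next
  \<open>t\<close> telescopes, because stopped points stay where they are.\<close>

lemma Q_semigroup_Chapman_Kolmogorov:
  assumes h: "h \<in> bounded_measurable_on state_space" and y: "y \<in> state_space"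
    and s: "s \<ge> 0" and t: "t \<ge> 0" and lam: "lam > 0"
  shows "Q_semigroup lam z (s + t) h y = Q_semigroup lam z s (Q_semigroup lam z t h) y"
proof -
  obtain i x where i: "i = 0 \<or> i = 1" "y = (i, x)"
    using y by (auto simp: state_space_def)
  note h1 = bounded_measurable_section[OF h, of 1, simplified]
  note g = bounded_measurable_visit_prob[OF lam, of z]
  note [measurable] = bounded_measurable_measurable[OF h1] bounded_measurable_measurable[OF g]
  let ?g = "visit_prob lam z" and ?hg = "\<lambda>\<eta>. h (1, \<eta>) * visit_prob lam z \<eta>"
  let ?P = "drift_op lam"
  have hg: "bounded_measurable ?hg"
    by (intro bounded_measurable_mult h1 g)
  have Q1: "Q_semigroup lam z t h (1, \<eta>) = h (0, z) * (1 - ?P t ?g \<eta> / ?g \<eta>) + ?P t ?hg \<eta> / ?g \<eta>" for \<eta>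
    using t lam by (intro Q_semigroup_1) auto
  have m: "(\<lambda>\<eta>. Q_semigroup lam z t h (1, \<eta>)) \<in> borel_measurable borel"
    unfolding Q1 by measurable
  have "(\<lambda>\<eta>. Q_semigroup lam z t h (1, \<eta>) * ?g \<eta>) = (\<lambda>\<eta>. h (0, z) * ?g \<eta> + ((- h (0, z)) * ?P t ?g \<eta> + ?P t ?hg \<eta>))"
    unfolding Q1 by (auto simp: field_simps)
  then have "?P s (\<lambda>\<eta>. Q_semigroup lam z t h (1, \<eta>) * ?g \<eta>) x =
      h (0, z) * ?P s ?g x + (- h (0, z) * ?P s (?P t ?g) x + ?P s (?P t ?hg) x)"
    using g hg by (simp only: drift_op_add drift_op_cmult bounded_measurable_mult bounded_measurable_const
        bounded_measurable_drift_op bounded_measurable_add)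
  then have "?P s (\<lambda>\<eta>. Q_semigroup lam z t h (1, \<eta>) * ?g \<eta>) x =
      h (0, z) * ?P s ?g x - h (0, z) * ?P (s + t) ?g x + ?P (s + t) ?hg x"
    using s t g hg by (simp add: drift_op_semigroup)
  then have "Q_semigroup lam z s (Q_semigroup lam z t h) (1, x) = Q_semigroup lam z (s + t) h (1, x)"
    using s t lam by (subst Q_semigroup_1[OF m s lam], subst Q_semigroup_1) (auto simp: Q_semigroup_0 field_simps)
  with i show ?thesis
    by (auto simp: Q_semigroup_0)
qed

text \<open>Integrates out the uniform variable that decides between moving on and stopping.\<close>

lemma uniform_integral_threshold:
  fixes a b c :: real
  assumes "0 \<le> c" "c \<le> 1"
  shows "(\<integral>u. (if u \<le> c then a else b) \<partial>uniform_measure lborel {0..1}) = a * c + b * (1 - c)"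
proof -
  interpret U: prob_space "uniform_measure lborel {0..1::real}"
    by (rule prob_space_uniform_measure) auto
  have "(\<integral>u. (if u \<le> c then a else b) \<partial>uniform_measure lborel {0..1}) =
      (\<integral>u. b + (a - b) * indicator {..c} u \<partial>uniform_measure lborel {0..1})"
    by (intro Bochner_Integration.integral_cong) (auto simp: indicator_def)
  also have "\<dots> = b + (a - b) * measure (uniform_measure lborel {0..1}) {..c}"
    by (subst Bochner_Integration.integral_add)
       (auto simp: U.prob_space[simplified] intro!: integrable_mult_right U.integrable_const_bound[where B=1])
  also have "measure (uniform_measure lborel {0..1}) {..c} = c"
  proof -
    have "{0..1} \<inter> {..c} = {0..c}" using assms by auto
    then show ?thesis using assms by (simp add: measure_uniform_measure)
  qed
  finally show ?thesis by (simp add: algebra_simps)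
qed

text \<open>The kernel of \<open>Q\<close> is realised as the law of a random map: a Gaussian step, with the drift turned
  downwards above the level so that the acceptance probability is at most 1, then a uniform variable
  deciding whether the path is stopped.\<close>

definition step_map :: "real \<Rightarrow> real \<Rightarrow> real \<Rightarrow> real \<times> real \<Rightarrow> real \<times> real \<Rightarrow> real \<times> real" where
  "step_map lam z t = (\<lambda>(i, x) (w, u). if i = 0 then (i, x) else
     let \<eta> = x + (if x \<le> z then lam else - lam) * t + sqrt t * w in
       if u \<le> (if x \<le> z then visit_prob lam z \<eta> else visit_prob_dual lam z \<eta>) then (1, \<eta>) else (0, z))"

text \<open>The image of one fixed product measure depends measurably on \<open>y\<close> once
  \<open>step_map\<close> is jointly measurable; no measurability of the explicit formula in
  \<open>y\<close> has to be examined.\<close>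

lemma Q_semigroup_kernel:
  assumes t: "t \<ge> 0" and lam: "lam > 0"
  shows "\<exists>\<kappa> \<in> borel_on state_space \<rightarrow>\<^sub>M prob_algebra (borel_on state_space).
    \<forall>h\<in>bounded_measurable_on state_space. \<forall>y\<in>state_space.
      Q_semigroup lam z t h y = (\<integral>x. h x \<partial>\<kappa> y)"
proof
  let ?U = "uniform_measure lborel {0..1::real}" and ?N = "std_normal_distribution"
  let ?E = "borel_on state_space"
  interpret U: prob_space ?U
    by (rule prob_space_uniform_measure) auto
  interpret NU: pair_prob_space ?N ?U ..
  have [measurable]: "visit_prob lam z \<in> borel_measurable borel" "visit_prob_dual lam z \<in> borel_measurable borel"
    by (intro bounded_measurable_measurable bounded_measurable_visit_prob bounded_measurable_visit_prob_dual lam)+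
  define \<kappa> where "\<kappa> y = distr (?N \<Otimes>\<^sub>M ?U) ?E (step_map lam z t y)" for y
  have E: "step_map lam z t y p \<in> state_space" if "y \<in> state_space" for y p
    using that by (auto simp: step_map_def state_space_def Let_def split: prod.splits)
  have [measurable]: "case_prod (step_map lam z t) \<in> (borel \<Otimes>\<^sub>M borel) \<Otimes>\<^sub>M (?N \<Otimes>\<^sub>M ?U) \<rightarrow>\<^sub>M borel \<Otimes>\<^sub>M borel"
  proof -
    let ?D = "(borel \<Otimes>\<^sub>M borel) \<Otimes>\<^sub>M (?N \<Otimes>\<^sub>M ?U) :: ((real \<times> real) \<times> real \<times> real) measure"
    define \<eta> where "\<eta> q = snd (fst q) + (if snd (fst q) \<le> z then lam else - lam) * t + sqrt t * fst (snd q)"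
      for q :: "(real \<times> real) \<times> real \<times> real"
    define G where "G q = (if snd (fst q) \<le> z then visit_prob lam z (\<eta> q) else visit_prob_dual lam z (\<eta> q))" for q
    have [measurable]: "(\<lambda>q. snd (fst q)) \<in> borel_measurable ?D" "(\<lambda>q. fst (fst q)) \<in> borel_measurable ?D"
      "(\<lambda>q. fst (snd q)) \<in> borel_measurable ?D" "(\<lambda>q. snd (snd q)) \<in> borel_measurable ?D"
      by (simp_all cong: measurable_cong_sets)
    have [measurable]: "\<eta> \<in> borel_measurable ?D"
      unfolding \<eta>_def by measurable
    have [measurable]: "G \<in> borel_measurable ?D"
      unfolding G_def by measurable
    have "case_prod (step_map lam z t) =
        (\<lambda>q. if fst (fst q) = 0 then fst q else if snd (snd q) \<le> G q then (1, \<eta> q) else (0, z))"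
      by (auto simp: step_map_def G_def \<eta>_def Let_def)
    then show ?thesis
      by simp
  qed
  have [measurable]: "(\<lambda>y. y) \<in> ?E \<rightarrow>\<^sub>M borel \<Otimes>\<^sub>M borel"
    unfolding borel_prod by (rule measurable_restrict_space1) simp
  have "(\<lambda>q. case_prod (step_map lam z t) (fst q, snd q)) \<in> ?E \<Otimes>\<^sub>M (?N \<Otimes>\<^sub>M ?U) \<rightarrow>\<^sub>M borel \<Otimes>\<^sub>M borel"
    by measurable
  then have "case_prod (step_map lam z t) \<in> ?E \<Otimes>\<^sub>M (?N \<Otimes>\<^sub>M ?U) \<rightarrow>\<^sub>M borel"
    by (simp add: borel_prod case_prod_beta)
  then have meas: "case_prod (step_map lam z t) \<in> ?E \<Otimes>\<^sub>M (?N \<Otimes>\<^sub>M ?U) \<rightarrow>\<^sub>M ?E"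
    by (intro measurable_restrict_space2) (auto simp: space_pair_measure space_restrict_space intro!: E)
  have meas1: "step_map lam z t y \<in> ?N \<Otimes>\<^sub>M ?U \<rightarrow>\<^sub>M ?E" if "y \<in> state_space" for y
    using measurable_Pair2[OF meas, of y] that by (simp add: space_restrict_space)
  show "\<kappa> \<in> ?E \<rightarrow>\<^sub>M prob_algebra ?E"
    unfolding \<kappa>_def
    by (rule measurable_distr_prob_space2[OF measurable_const]) (use meas in \<open>simp_all add: space_prob_algebra NU.prob_space_axioms\<close>)
  show "\<forall>h\<in>bounded_measurable_on state_space. \<forall>y\<in>state_space. Q_semigroup lam z t h y = (\<integral>x. h x \<partial>\<kappa> y)"
  proof (intro ballI)
    fix h y assume h: "h \<in> bounded_measurable_on state_space" and y: "y \<in> state_space"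
    then have [measurable]: "h \<in> borel_measurable ?E"
      by (simp add: bounded_measurable_on_def)
    obtain C where C: "\<And>y. y \<in> state_space \<Longrightarrow> \<bar>h y\<bar> \<le> C"
      using h by (auto simp: bounded_measurable_on_def bounded_iff)
    note [measurable] = meas1[OF y]
    obtain i x where i: "i = 0 \<or> i = 1" "y = (i, x)"
      using y by (auto simp: state_space_def)
    have int: "integrable (?N \<Otimes>\<^sub>M ?U) (\<lambda>p. h (step_map lam z t y p))"
      by (rule NU.integrable_const_bound[where B=C]) (auto intro!: C E y)
    have "(\<integral>x. h x \<partial>\<kappa> y) = (\<integral>p. h (step_map lam z t y p) \<partial>(?N \<Otimes>\<^sub>M ?U))"
      unfolding \<kappa>_def by (rule integral_distr) auto
    also have "\<dots> = (\<integral>w. \<integral>u. h (step_map lam z t y (w, u)) \<partial>?U \<partial>?N)"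
      using NU.integral_fst'[OF int] by simp
    also have "\<dots> = Q_semigroup lam z t h y"
    proof (cases "i = 0")
      case True
      then show ?thesis
        using i by (simp add: step_map_def Q_semigroup_0 std_normal.prob_space[simplified] U.prob_space[simplified])
    next
      case False
      define mu where "mu = (if x \<le> z then lam else - lam)"
      define G where "G = (if x \<le> z then visit_prob lam z else visit_prob_dual lam z)"
      have G: "bounded_measurable G" "\<And>\<eta>. 0 \<le> G \<eta>" "\<And>\<eta>. G \<eta> \<le> 1"
        using lam by (auto simp: G_def bounded_measurable_visit_prob bounded_measurable_visit_prob_dual
          visit_prob_le_1 visit_prob_dual_le_1 less_imp_le)
      note h1 = bounded_measurable_section[OF h, of 1, simplified]
      have ht: "drift_op lam t (\<lambda>\<eta>. \<phi> \<eta> * visit_prob lam z \<eta>) x / visit_prob lam z x = drift_op mu t (\<lambda>\<eta>. \<phi> \<eta> * G \<eta>) x"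
        if "bounded_measurable \<phi>" for \<phi>
        using h_transform_eq[OF bounded_measurable_measurable[OF that] t, of lam z x] by (simp add: mu_def G_def if_distrib)
      \<comment> \<open>Given the Gaussian step, the uniform variable accepts the new position with
        probability \<open>G\<close>.\<close>
      have "(\<integral>w. \<integral>u. h (step_map lam z t y (w, u)) \<partial>?U \<partial>?N) =
          drift_op mu t (\<lambda>\<eta>. h (1, \<eta>) * G \<eta> + h (0, z) * (1 + (- 1) * G \<eta>)) x"
        unfolding drift_op_def
      proof (intro Bochner_Integration.integral_cong refl)
        fix w
        let ?\<eta> = "x + mu * t + sqrt t * w"
        have "(\<integral>u. h (step_map lam z t y (w, u)) \<partial>?U) = (\<integral>u. (if u \<le> G ?\<eta> then h (1, ?\<eta>) else h (0, z)) \<partial>?U)"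
          using i False by (intro Bochner_Integration.integral_cong) (auto simp: step_map_def Let_def mu_def G_def)
        then show "(\<integral>u. h (step_map lam z t y (w, u)) \<partial>?U) = h (1, ?\<eta>) * G ?\<eta> + h (0, z) * (1 + (- 1) * G ?\<eta>)"
          using G by (simp add: uniform_integral_threshold)
      qed
      also have "\<dots> = drift_op mu t (\<lambda>\<eta>. h (1, \<eta>) * G \<eta>) x + h (0, z) * (1 + (- 1) * drift_op mu t G x)"
        using G(1) h1 by (simp only: drift_op_add drift_op_cmult drift_op_const bounded_measurable_mult bounded_measurable_const
          bounded_measurable_add)
      \<comment> \<open>At the constant 1, \<open>ht\<close> identifies
        \<open>drift_op mu t G x\<close> with the survival probability.\<close>
      also have "\<dots> = Q_semigroup lam z t h y"
        using i False lam t h1 ht[OF h1] ht[OF bounded_measurable_const, of 1]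
        by (simp add: Q_semigroup_1 bounded_measurable_measurable)
      finally show ?thesis .
    qed
    finally show "Q_semigroup lam z t h y = (\<integral>x. h x \<partial>\<kappa> y)" ..
  qed
qed

lemma markov_semigroup_on_Q_semigroup:
  assumes "lam > 0"
  shows "markov_semigroup_on state_space (Q_semigroup lam z)"
  unfolding markov_semigroup_on_def
proof (intro conjI ballI allI impI)
  fix h :: "real \<times> real \<Rightarrow> real" and y
  show "Q_semigroup lam z 0 h y = h y"
    by (simp add: Q_semigroup_def)
qed (use Q_semigroup_kernel[OF _ assms] Q_semigroup_Chapman_Kolmogorov[OF _ _ _ _ assms] in blast)+

section \<open>The Feller property\<close>

lemma C0_onD:
  assumes "h \<in> C0_on E" "\<epsilon> > 0"
  obtains K where "compact K" "K \<subseteq> E" "\<And>y. y \<in> E - K \<Longrightarrow> \<bar>h y\<bar> < \<epsilon>"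
proof -
  have "\<exists>K. compact K \<and> K \<subseteq> E \<and> (\<forall>y\<in>E - K. \<bar>h y\<bar> < \<epsilon>)"
    using assms by (simp add: C0_on_def)
  then show thesis
    using that by metis
qed

lemma C0_on_section_tendsto:
  assumes h: "h \<in> C0_on state_space" and i: "i = 0 \<or> i = 1"
  shows "((\<lambda>\<eta>. h (i, \<eta>)) \<longlongrightarrow> 0) at_top" and "((\<lambda>\<eta>. h (i, \<eta>)) \<longlongrightarrow> 0) at_bot"
proof -
  have R: "\<exists>R. \<forall>\<eta>. \<bar>\<eta>\<bar> > R \<longrightarrow> \<bar>h (i, \<eta>)\<bar> < \<epsilon>" if pos: "\<epsilon> > 0" for \<epsilon>
  proof -
    obtain K where K: "compact K" "\<And>y. y \<in> state_space - K \<Longrightarrow> \<bar>h y\<bar> < \<epsilon>"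
      using C0_onD[OF h pos] by metis
    obtain R where R: "\<And>y. y \<in> K \<Longrightarrow> norm y \<le> R"
      using compact_imp_bounded[OF K(1)] unfolding bounded_iff by blast
    have "\<bar>h (i, \<eta>)\<bar> < \<epsilon>" if "\<bar>\<eta>\<bar> > R" for \<eta>
      using R[of "(i, \<eta>)"] norm_snd_le[of \<eta> i] that i
      by (intro K(2)) (auto simp: state_space_def)
    then show ?thesis by blast
  qed
  show "((\<lambda>\<eta>. h (i, \<eta>)) \<longlongrightarrow> 0) at_top"
  proof (rule tendstoI)
    fix \<epsilon> :: real assume "\<epsilon> > 0"
    then obtain R where "\<And>\<eta>. \<bar>\<eta>\<bar> > R \<Longrightarrow> \<bar>h (i, \<eta>)\<bar> < \<epsilon>" using R by blast
    then show "\<forall>\<^sub>F \<eta> in at_top. dist (h (i, \<eta>)) 0 < \<epsilon>"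
      by (intro eventually_mono[OF eventually_gt_at_top[of "\<bar>R\<bar>"]]) auto
  qed
  show "((\<lambda>\<eta>. h (i, \<eta>)) \<longlongrightarrow> 0) at_bot"
  proof (rule tendstoI)
    fix \<epsilon> :: real assume "\<epsilon> > 0"
    then obtain R where "\<And>\<eta>. \<bar>\<eta>\<bar> > R \<Longrightarrow> \<bar>h (i, \<eta>)\<bar> < \<epsilon>" using R by blast
    then show "\<forall>\<^sub>F \<eta> in at_bot. dist (h (i, \<eta>)) 0 < \<epsilon>"
      by (intro eventually_mono[OF eventually_gt_at_bot[of "- \<bar>R\<bar>"]]) auto
  qed
qed

lemma C0_on_section_continuous:
  assumes h: "h \<in> C0_on state_space" and i: "i = 0 \<or> i = 1"
  shows "continuous_on UNIV (\<lambda>\<eta>. h (i, \<eta>))"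
  by (rule continuous_on_compose2[of state_space h])
     (use h i in \<open>auto simp: C0_on_def state_space_def intro!: continuous_intros\<close>)

lemma C0_on_section_bounded_measurable:
  assumes h: "h \<in> C0_on state_space" and i: "i = 0 \<or> i = 1"
  shows "bounded_measurable (\<lambda>\<eta>. h (i, \<eta>))"
proof -
  obtain K where K: "compact K" "K \<subseteq> state_space" "\<And>y. y \<in> state_space - K \<Longrightarrow> \<bar>h y\<bar> < 1"
    using C0_onD[OF h zero_less_one] by metis
  have "compact (h ` K)"
    using h K continuous_on_subset by (intro compact_continuous_image) (auto simp: C0_on_def)
  then have "bounded (h ` K)"
    by (rule compact_imp_bounded)
  then obtain R where R: "\<And>y. y \<in> K \<Longrightarrow> \<bar>h y\<bar> \<le> R"
    by (auto simp: bounded_iff)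
  show ?thesis
  proof (rule bounded_measurableI[where C="max R 1"])
    show "(\<lambda>\<eta>. h (i, \<eta>)) \<in> borel_measurable borel"
      by (intro borel_measurable_continuous_onI C0_on_section_continuous h i)
    show "\<bar>h (i, \<eta>)\<bar> \<le> max R 1" for \<eta>
      using R[of "(i, \<eta>)"] K(3)[of "(i, \<eta>)"] i by (fastforce simp: state_space_def)
  qed
qed

lemma C0_on_state_spaceI:
  assumes cont: "continuous_on state_space h"
    and top: "\<And>i. i = 0 \<or> i = 1 \<Longrightarrow> ((\<lambda>\<eta>. h (i, \<eta>)) \<longlongrightarrow> 0) at_top"
    and bot: "\<And>i. i = 0 \<or> i = 1 \<Longrightarrow> ((\<lambda>\<eta>. h (i, \<eta>)) \<longlongrightarrow> 0) at_bot"
  shows "h \<in> C0_on state_space"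
  unfolding C0_on_def
proof (intro CollectI conjI allI impI cont)
  fix \<epsilon> :: real assume \<epsilon>: "\<epsilon> > 0"
  have "\<forall>\<^sub>F \<eta> in at_top. \<bar>h (0, \<eta>)\<bar> < \<epsilon> \<and> \<bar>h (1, \<eta>)\<bar> < \<epsilon>"
    using tendstoD[OF top[of 0] \<epsilon>] tendstoD[OF top[of 1] \<epsilon>] by (simp add: eventually_conj)
  then obtain a where a: "\<And>\<eta>. \<eta> \<ge> a \<Longrightarrow> \<bar>h (0, \<eta>)\<bar> < \<epsilon> \<and> \<bar>h (1, \<eta>)\<bar> < \<epsilon>"
    unfolding eventually_at_top_linorder by blast
  have "\<forall>\<^sub>F \<eta> in at_bot. \<bar>h (0, \<eta>)\<bar> < \<epsilon> \<and> \<bar>h (1, \<eta>)\<bar> < \<epsilon>"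
    using tendstoD[OF bot[of 0] \<epsilon>] tendstoD[OF bot[of 1] \<epsilon>] by (simp add: eventually_conj)
  then obtain b where b: "\<And>\<eta>. \<eta> \<le> b \<Longrightarrow> \<bar>h (0, \<eta>)\<bar> < \<epsilon> \<and> \<bar>h (1, \<eta>)\<bar> < \<epsilon>"
    unfolding eventually_at_bot_linorder by blast
  show "\<exists>K. compact K \<and> K \<subseteq> state_space \<and> (\<forall>y\<in>state_space - K. \<bar>h y\<bar> < \<epsilon>)"
  proof (intro exI conjI ballI)
    \<comment> \<open>If \<open>b > a\<close> the rectangle is empty, and every point still lies
      beyond one of the two bounds.\<close>
    show "compact ({0, 1} \<times> {b..a} :: (real \<times> real) set)"
      by (intro compact_Times finite_imp_compact compact_Icc) auto
    fix y assume "y \<in> state_space - {0, 1} \<times> {b..a}"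
    then show "\<bar>h y\<bar> < \<epsilon>"
      using a[of "snd y"] b[of "snd y"] by (cases y) (force simp: state_space_def)
  qed (auto simp: state_space_def)
qed

lemma h_transform_at_bot:
  assumes \<phi>: "bounded_measurable \<phi>" and lim: "(\<phi> \<longlongrightarrow> l) at_bot" and t: "t \<ge> 0" and lam: "lam > 0"
  shows "((\<lambda>x. drift_op lam t (\<lambda>\<eta>. \<phi> \<eta> * visit_prob lam z \<eta>) x / visit_prob lam z x) \<longlongrightarrow> l) at_bot"
proof -
  have "((\<lambda>\<eta>. \<phi> \<eta> * visit_prob lam z \<eta>) \<longlongrightarrow> l * 1) at_bot"
    by (intro tendsto_mult lim visit_prob_at_bot)
  then have "(drift_op lam t (\<lambda>\<eta>. \<phi> \<eta> * visit_prob lam z \<eta>) \<longlongrightarrow> l) at_bot"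
    by (intro drift_op_tendsto_at_bot bounded_measurable_mult \<phi> bounded_measurable_visit_prob lam) simp
  from tendsto_divide[OF this visit_prob_at_bot] show ?thesis
    by simp
qed

text \<open>Numerator and denominator both tend to 0 here. After the reversal of the drift the
  weight tends to 1 instead, and the limit can be taken inside the operator.\<close>

lemma h_transform_at_top:
  assumes \<phi>: "bounded_measurable \<phi>" and lim: "(\<phi> \<longlongrightarrow> l) at_top" and t: "t \<ge> 0" and lam: "lam > 0"
  shows "((\<lambda>x. drift_op lam t (\<lambda>\<eta>. \<phi> \<eta> * visit_prob lam z \<eta>) x / visit_prob lam z x) \<longlongrightarrow> l) at_top"
proof -
  have "((\<lambda>\<eta>. \<phi> \<eta> * visit_prob_dual lam z \<eta>) \<longlongrightarrow> l * 1) at_top"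
    by (intro tendsto_mult lim visit_prob_dual_at_top)
  then have "(drift_op (- lam) t (\<lambda>\<eta>. \<phi> \<eta> * visit_prob_dual lam z \<eta>) \<longlongrightarrow> l) at_top"
    by (intro drift_op_tendsto_at_top bounded_measurable_mult \<phi> bounded_measurable_visit_prob_dual lam) simp
  moreover have "\<forall>\<^sub>F x in at_top. drift_op (- lam) t (\<lambda>\<eta>. \<phi> \<eta> * visit_prob_dual lam z \<eta>) x =
      drift_op lam t (\<lambda>\<eta>. \<phi> \<eta> * visit_prob lam z \<eta>) x / visit_prob lam z x"
    using eventually_gt_at_top[of z]
    by eventually_elim (use h_transform_eq[OF bounded_measurable_measurable[OF \<phi>] t] in simp)
  ultimately show ?thesis
    by (rule Lim_transform_eventually)
qed

lemma Q_semigroup_C0: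
  assumes h: "h \<in> C0_on state_space" and t: "t \<ge> 0" and lam: "lam > 0"
  shows "Q_semigroup lam z t h \<in> C0_on state_space"
proof -
  let ?g = "visit_prob lam z" and ?P = "drift_op lam t"
  let ?k = "\<lambda>x. h (0, z) * (1 - ?P ?g x / ?g x) + ?P (\<lambda>\<eta>. h (1, \<eta>) * ?g \<eta>) x / ?g x"
  note h1 = C0_on_section_bounded_measurable[OF h, of 1, simplified]
  note g = bounded_measurable_visit_prob[OF lam, of z]
  have Q1: "Q_semigroup lam z t h (1, x) = ?k x" for x
    using t lam by (intro Q_semigroup_1 bounded_measurable_measurable h1)
  have k: "continuous_on UNIV ?k"
    using C0_on_section_continuous[OF h, of 1]
    by (intro continuous_intros continuous_on_drift_op continuous_on_visit_prob bounded_measurable_mult g h1) auto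
  \<comment> \<open>Interpolating affinely in the first coordinate gives one formula for both
    fibres, hence continuity on their union.\<close>
  have "continuous_on state_space (\<lambda>y. (1 - fst y) * h y + fst y * ?k (snd y))"
    using h by (intro continuous_intros continuous_on_compose2[OF k]) (auto simp: C0_on_def)
  moreover have "Q_semigroup lam z t h y = (1 - fst y) * h y + fst y * ?k (snd y)" if "y \<in> state_space" for y
    using that Q1 by (auto simp: state_space_def Q_semigroup_0)
  ultimately have cont: "continuous_on state_space (Q_semigroup lam z t h)"
    by (simp cong: continuous_on_cong)
  note lim = C0_on_section_tendsto[OF h]
  \<comment> \<open>Far from \<open>z\<close> on either side the survival probability tends to 1, so
    the mass at \<open>(0, z)\<close> vanishes in the limit.\<close>
  have "((\<lambda>x. Q_semigroup lam z t h (1, x)) \<longlongrightarrow> h (0, z) * (1 - 1) + 0) at_top"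
    unfolding Q1 by (intro tendsto_intros h_transform_at_top[of "\<lambda>_. 1", simplified]
      h_transform_at_top h1 lim lam t bounded_measurable_const) auto
  moreover have "((\<lambda>x. Q_semigroup lam z t h (1, x)) \<longlongrightarrow> h (0, z) * (1 - 1) + 0) at_bot"
    unfolding Q1 by (intro tendsto_intros h_transform_at_bot[of "\<lambda>_. 1", simplified]
      h_transform_at_bot h1 lim lam t bounded_measurable_const) auto
  ultimately show ?thesis
    using cont lim by (intro C0_on_state_spaceI) (auto simp: Q_semigroup_0)
qed

lemma Q_semigroup_tendsto_0:
  assumes h: "h \<in> C0_on state_space" and y: "y \<in> state_space" and lam: "lam > 0"
  shows "((\<lambda>t. Q_semigroup lam z t h y) \<longlongrightarrow> h y) (at_right 0)"
proof -
  let ?g = "visit_prob lam z" and ?P = "drift_op lam"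
  obtain i x where i: "i = 0 \<or> i = 1" "y = (i, x)"
    using y by (auto simp: state_space_def)
  note h1 = C0_on_section_bounded_measurable[OF h, of 1, simplified]
  note g = bounded_measurable_visit_prob[OF lam, of z]
  have "((\<lambda>t. h (0, z) * (1 - ?P t ?g x / ?g x) + ?P t (\<lambda>\<eta>. h (1, \<eta>) * ?g \<eta>) x / ?g x)
      \<longlongrightarrow> h (0, z) * (1 - ?g x / ?g x) + h (1, x) * ?g x / ?g x) (at_right 0)"
    using C0_on_section_continuous[OF h, of 1]
    by (intro tendsto_intros drift_op_tendsto_0 bounded_measurable_mult g h1 continuous_on_visit_prob continuous_on_mult) auto
  moreover have "\<forall>\<^sub>F t in at_right 0. h (0, z) * (1 - ?P t ?g x / ?g x) + ?P t (\<lambda>\<eta>. h (1, \<eta>) * ?g \<eta>) x / ?g x =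
      Q_semigroup lam z t h (1, x)"
    using eventually_at_right_less[of 0]
    by eventually_elim (intro Q_semigroup_1[symmetric] bounded_measurable_measurable h1 lam, simp)
  ultimately have "((\<lambda>t. Q_semigroup lam z t h (1, x)) \<longlongrightarrow> h (1, x)) (at_right 0)"
    using Lim_transform_eventually by force
  with i show ?thesis
    by (auto simp: Q_semigroup_0)
qed

section \<open>The Markov property of Brownian motion with drift\<close>

locale brownian_motion = prob_space M for M :: "'a measure" +
  fixes B :: "real \<Rightarrow> 'a \<Rightarrow> real" and lam :: real
  assumes brownian: "standard_brownian_motion M B" and lam_pos: "lam > 0"
begin

text \<open>Subtracting the initial value, which vanishes only almost surely, makes the process start
  at 0 everywhere.\<close>

definition X :: "real \<Rightarrow> 'a \<Rightarrow> real" where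
  "X u \<omega> = B u \<omega> - B 0 \<omega> + lam * u"

text \<open>An intersection-stable generator of the past, written in increments from time 0 because
  the independence assumption speaks about increments.\<close>

definition cylinders :: "real \<Rightarrow> 'a set set" where
  "cylinders s = {{\<omega>\<in>space M. \<forall>u\<in>J. B u \<omega> - B 0 \<omega> \<in> C u} | J C.
     finite J \<and> J \<subseteq> {0..s} \<and> (\<forall>u. C u \<in> sets borel)}"

definition past :: "real \<Rightarrow> 'a measure" where
  "past s = sigma (space M) (cylinders s)"

lemma B_measurable [measurable]: "t \<ge> 0 \<Longrightarrow> B t \<in> borel_measurable M"
  using brownian by (simp add: standard_brownian_motion_def)

lemma increment_distributed:
  assumes "0 \<le> s" "0 < t"
  shows "distributed M lborel (\<lambda>\<omega>. B (s + t) \<omega> - B s \<omega>) (normal_density 0 (sqrt t))"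
proof -
  have "\<forall>s t. 0 \<le> s \<longrightarrow> s < t \<longrightarrow>
      distributed M lborel (\<lambda>\<omega>. B t \<omega> - B s \<omega>) (normal_density 0 (sqrt (t - s)))"
    using brownian unfolding standard_brownian_motion_def by blast
  from this[rule_format, of s "s + t"] show ?thesis
    using assms by simp
qed

lemma increments_indep:
  "0 \<le> \<tau> 0 \<Longrightarrow> (\<And>i. i < n \<Longrightarrow> \<tau> i \<le> \<tau> (Suc i)) \<Longrightarrow>
    indep_vars (\<lambda>_. borel) (\<lambda>i \<omega>. B (\<tau> (Suc i)) \<omega> - B (\<tau> i) \<omega>) {..<n}"
  using brownian unfolding standard_brownian_motion_def by blast

section \<open>The past and its independence of the next increment\<close>

lemma cylinders_Pow: "cylinders s \<subseteq> Pow (space M)"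
  by (auto simp: cylinders_def)

lemma cylinders_events: "cylinders s \<subseteq> events"
proof
  fix A assume "A \<in> cylinders s"
  then obtain J C where A: "A = {\<omega>\<in>space M. \<forall>u\<in>J. B u \<omega> - B 0 \<omega> \<in> C u}"
    and J: "finite J" "J \<subseteq> {0..s}" "\<And>u. C u \<in> sets borel"
    unfolding cylinders_def by blast
  have "{\<omega>\<in>space M. B u \<omega> - B 0 \<omega> \<in> C u} \<in> events" if "u \<in> J" for u
  proof -
    have "(\<lambda>\<omega>. B u \<omega> - B 0 \<omega>) \<in> borel_measurable M"
      using that J by (intro borel_measurable_diff B_measurable) auto
    from measurable_sets[OF this J(3)[of u]] show ?thesis
      by (simp add: vimage_def Int_def conj_commute)
  qed
  then show "A \<in> events"
    unfolding A using J(1) by (intro sets.sets_Collect_finite_All)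
qed

lemma Int_stable_cylinders: "Int_stable (cylinders s)"
proof (rule Int_stableI)
  fix a b assume "a \<in> cylinders s" "b \<in> cylinders s"
  then obtain J C K D where J: "finite J" "J \<subseteq> {0..s}" "\<And>u. C u \<in> sets borel"
    and K: "finite K" "K \<subseteq> {0..s}" "\<And>u. D u \<in> sets borel"
    and ab: "a = {\<omega>\<in>space M. \<forall>u\<in>J. B u \<omega> - B 0 \<omega> \<in> C u}" "b = {\<omega>\<in>space M. \<forall>u\<in>K. B u \<omega> - B 0 \<omega> \<in> D u}"
    unfolding cylinders_def by blast
  let ?C = "\<lambda>u. (if u \<in> J then C u else UNIV) \<inter> (if u \<in> K then D u else UNIV)"
  have "a \<inter> b = {\<omega>\<in>space M. \<forall>u\<in>J \<union> K. B u \<omega> - B 0 \<omega> \<in> ?C u}"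
    unfolding ab by auto
  moreover have "\<forall>u. ?C u \<in> sets borel"
    using J K by auto
  ultimately show "a \<inter> b \<in> cylinders s"
    unfolding cylinders_def using J(1,2) K(1,2)
    by (intro CollectI exI[of _ "J \<union> K"] exI[of _ ?C]) auto
qed

lemma space_past [simp]: "space (past s) = space M"
  by (simp add: past_def space_measure_of_conv)

lemma sets_past: "sets (past s) = sigma_sets (space M) (cylinders s)"
  using cylinders_Pow by (simp add: past_def sets_measure_of)

lemma sets_past_subset: "sets (past s) \<subseteq> events"
  unfolding sets_past by (rule sets.sigma_sets_subset[OF cylinders_events])

lemma sets_past_mono: "s \<le> t \<Longrightarrow> sets (past s) \<subseteq> sets (past t)"
  unfolding sets_past
proof (rule sigma_sets_mono', rule subsetI)
  fix A assume "s \<le> t" "A \<in> cylinders s"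
  then have "{0..s} \<subseteq> {0..t}" and "\<exists>J C. A = {\<omega>\<in>space M. \<forall>u\<in>J. B u \<omega> - B 0 \<omega> \<in> C u} \<and>
      finite J \<and> J \<subseteq> {0..s} \<and> (\<forall>u. C u \<in> sets borel)"
    unfolding cylinders_def by auto
  then show "A \<in> cylinders t"
    unfolding cylinders_def by blast
qed

lemma measurable_past: "f \<in> past s \<rightarrow>\<^sub>M N \<Longrightarrow> f \<in> M \<rightarrow>\<^sub>M N"
  using sets_past_subset[of s] by (auto simp: measurable_def)

lemma X_past:
  assumes "0 \<le> u" "u \<le> s" shows "X u \<in> borel_measurable (past s)"
proof -
  have "(\<lambda>\<omega>. B u \<omega> - B 0 \<omega>) \<in> borel_measurable (past s)"
  proof (rule measurableI)
    fix A :: "real set" assume "A \<in> sets borel"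
    then have "{\<omega>\<in>space M. \<forall>v\<in>{u}. B v \<omega> - B 0 \<omega> \<in> A} \<in> cylinders s"
      unfolding cylinders_def using assms by (intro CollectI exI[of _ "{u}"] exI[of _ "\<lambda>_. A"]) auto
    then show "(\<lambda>\<omega>. B u \<omega> - B 0 \<omega>) -` A \<inter> space (past s) \<in> sets (past s)"
      unfolding sets_past by (auto intro!: sigma_sets.Basic simp: vimage_def Int_def conj_commute)
  qed simp
  then show ?thesis
    unfolding X_def by measurable
qed

lemma X_measurable [measurable]: "0 \<le> u \<Longrightarrow> X u \<in> borel_measurable M"
  using X_past[of u u] measurable_past by blast

text \<open>Sorting the constrained times yields a grid ending in \<open>s\<close> and then
  \<open>s + t\<close>. The cylinder is an event about partial sums of all grid increments but the
  last, and these are jointly independent of the last one.\<close>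

lemma cylinder_indep_increment:
  assumes A: "A \<in> cylinders s" and s: "0 \<le> s" and t: "0 < t" and D: "D \<in> sets borel"
  shows "prob (A \<inter> ((\<lambda>\<omega>. B (s + t) \<omega> - B s \<omega>) -` D \<inter> space M)) =
    prob A * prob ((\<lambda>\<omega>. B (s + t) \<omega> - B s \<omega>) -` D \<inter> space M)"
proof -
  obtain J C where A: "A = {\<omega>\<in>space M. \<forall>u\<in>J. B u \<omega> - B 0 \<omega> \<in> C u}"
    and J: "finite J" "J \<subseteq> {0..s}" "\<And>u. C u \<in> sets borel"
    using A unfolding cylinders_def by blast
  \<comment> \<open>Inserting 0 makes the partial sums start from \<open>B 0\<close>; inserting
    \<open>s\<close> makes the final increment start exactly at \<open>s\<close>.\<close>
  define L where "L = sorted_list_of_set (insert 0 (insert s J))"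
  define N where "N = length L - 1"
  \<comment> \<open>Beyond the list the grid sits at \<open>s + t\<close>, so the increment with
    index \<open>N\<close> runs from \<open>s\<close> to \<open>s + t\<close>.\<close>
  define \<tau> where "\<tau> i = (if i < length L then L ! i else s + t)" for i
  have L: "sorted L" "set L = insert 0 (insert s J)"
    unfolding L_def using J(1) by (intro sorted_sorted_list_of_set set_sorted_list_of_set; simp)+
  then have "L \<noteq> []" by auto
  then have len: "length L = Suc N"
    by (simp add: N_def)
  have nth: "L ! i \<in> {0..s}" if "i < length L" for i
    using nth_mem[OF that] L(2) J(2) s by auto
  have mono: "L ! i \<le> L ! j" if "i \<le> j" "j < length L" for i j
    using sorted_nth_mono[OF L(1) that] .
  obtain k0 where "k0 < length L" "L ! k0 = 0"
    using L(2) in_set_conv_nth[of 0 L] by auto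
  then have L0: "L ! 0 = 0"
    using mono[of 0 k0] nth[of 0] len by auto
  obtain k1 where "k1 < length L" "L ! k1 = s"
    using L(2) in_set_conv_nth[of s L] by auto
  then have LN: "L ! N = s"
    using mono[of k1 N] nth[of N] len by auto
  have \<tau>: "\<tau> 0 = 0" "\<tau> N = s" "\<tau> (Suc N) = s + t"
    using len L0 LN by (auto simp: \<tau>_def)
  have "\<tau> i \<le> \<tau> (Suc i)" if "i < Suc N" for i
    using that mono[of i "Suc i"] nth[of i] t by (auto simp: \<tau>_def len)
  then have ind: "indep_vars (\<lambda>_. borel) (\<lambda>i \<omega>. B (\<tau> (Suc i)) \<omega> - B (\<tau> i) \<omega>) {..<Suc N}"
    using \<tau>(1) by (intro increments_indep) auto
  let ?\<Delta> = "\<lambda>i \<omega>. B (\<tau> (Suc i)) \<omega> - B (\<tau> i) \<omega>"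
  let ?S = "\<lambda>I. PiM I (\<lambda>_. borel :: real measure)"
  have ind: "indep_var (?S {..<N}) (\<lambda>\<omega>. \<lambda>i\<in>{..<N}. ?\<Delta> i \<omega>) (?S {N}) (\<lambda>\<omega>. \<lambda>i\<in>{N}. ?\<Delta> i \<omega>)"
    by (rule indep_var_restrict[OF ind]) auto
  \<comment> \<open>The sum of the first \<open>k\<close> increments recovers the position at
    \<open>L ! k\<close> relative to \<open>B 0\<close>.\<close>
  define SA where "SA = {f\<in>space (?S {..<N}). \<forall>k\<in>{k. k \<le> N \<and> L ! k \<in> J}. (\<Sum>i<k. f i) \<in> C (L ! k)}"
  define SB where "SB = {f\<in>space (?S {N}). f N \<in> D}"
  have SA: "SA \<in> sets (?S {..<N})"
    unfolding SA_def
  proof (rule sets.sets_Collect_finite_All)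
    fix k assume "k \<in> {k. k \<le> N \<and> L ! k \<in> J}"
    then have "(\<lambda>f. \<Sum>i<k. f i) \<in> borel_measurable (?S {..<N})"
      by (intro borel_measurable_sum measurable_component_singleton) auto
    from measurable_sets[OF this J(3)[of "L ! k"]]
    show "{f \<in> space (?S {..<N}). (\<Sum>i<k. f i) \<in> C (L ! k)} \<in> sets (?S {..<N})"
      by (simp add: vimage_def Int_def conj_commute)
  qed auto
  have "(\<lambda>f. f N) \<in> borel_measurable (?S {N})"
    by (intro measurable_component_singleton) auto
  from measurable_sets[OF this D] have SB: "SB \<in> sets (?S {N})"
    by (simp add: SB_def vimage_def Int_def conj_commute)
  have sum: "(\<Sum>i<k. ?\<Delta> i \<omega>) = B (\<tau> k) \<omega> - B 0 \<omega>" for k \<omega>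
    using sum_lessThan_telescope[of "\<lambda>i. B (\<tau> i) \<omega>" k] by (simp add: \<tau>(1))
  have "A = (\<lambda>\<omega>. \<lambda>i\<in>{..<N}. ?\<Delta> i \<omega>) -` SA \<inter> space M"
  proof -
    have "(\<forall>u\<in>J. B u \<omega> - B 0 \<omega> \<in> C u) \<longleftrightarrow>
        (\<forall>k\<in>{k. k \<le> N \<and> L ! k \<in> J}. (\<Sum>i<k. (\<lambda>i\<in>{..<N}. ?\<Delta> i \<omega>) i) \<in> C (L ! k))" for \<omega>
    proof -
      have "(\<Sum>i<k. (\<lambda>i\<in>{..<N}. ?\<Delta> i \<omega>) i) = B (L ! k) \<omega> - B 0 \<omega>" if "k \<le> N" for k
      proof -
        have "(\<Sum>i<k. (\<lambda>i\<in>{..<N}. ?\<Delta> i \<omega>) i) = (\<Sum>i<k. ?\<Delta> i \<omega>)"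
          using that by (intro sum.cong) auto
        then show ?thesis
          unfolding sum using that len by (simp add: \<tau>_def)
      qed
      moreover have "u \<in> J \<Longrightarrow> \<exists>k\<le>N. u = L ! k" for u
        using L(2) len by (metis in_set_conv_nth insertCI less_Suc_eq_le)
      ultimately show ?thesis
        by (smt (verit) mem_Collect_eq)
    qed
    then show ?thesis
      unfolding A SA_def by (auto simp: space_PiM)
  qed
  note fA = this
  have fB: "(\<lambda>\<omega>. B (s + t) \<omega> - B s \<omega>) -` D \<inter> space M = (\<lambda>\<omega>. \<lambda>i\<in>{N}. ?\<Delta> i \<omega>) -` SB \<inter> space M"
    unfolding SB_def by (auto simp: \<tau> space_PiM)
  have "(\<lambda>\<omega>. (\<lambda>i\<in>{..<N}. ?\<Delta> i \<omega>, \<lambda>i\<in>{N}. ?\<Delta> i \<omega>)) -` (SA \<times> SB) \<inter> space M =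
      A \<inter> ((\<lambda>\<omega>. B (s + t) \<omega> - B s \<omega>) -` D \<inter> space M)"
    unfolding fA fB by blast
  then show ?thesis
    using indep_varD[OF ind SA SB] unfolding fA[symmetric] fB[symmetric] by (simp only:)
qed

lemma past_indep_increment:
  assumes s: "0 \<le> s" and t: "0 < t"
  shows "indep_set (sets (past s))
    (sigma_sets (space M) {(\<lambda>\<omega>. B (s + t) \<omega> - B s \<omega>) -` D \<inter> space M | D. D \<in> sets borel})"
  unfolding sets_past
proof (rule indep_set_sigma_sets[OF indep_setI])
  let ?D = "\<lambda>\<omega>. B (s + t) \<omega> - B s \<omega>"
  show "{?D -` D \<inter> space M | D. D \<in> sets borel} \<subseteq> events"
    using s t by auto
  show "Int_stable {?D -` D \<inter> space M | D. D \<in> sets borel}"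
  proof (rule Int_stableI, elim CollectE exE conjE)
    fix a b D E assume "a = ?D -` D \<inter> space M" "b = ?D -` E \<inter> space M" "D \<in> sets borel" "E \<in> sets borel"
    then show "a \<inter> b \<in> {?D -` D \<inter> space M | D. D \<in> sets borel}"
      by (intro CollectI exI[of _ "D \<inter> E"]) auto
  qed
qed (use cylinder_indep_increment[OF _ s t] cylinders_events Int_stable_cylinders in auto)

lemma X_add: "X (s + t) \<omega> = X s \<omega> + lam * t + (B (s + t) \<omega> - B s \<omega>)"
  by (simp add: X_def algebra_simps)

text \<open>The pair of \<open>indicator A\<close> and \<open>X s\<close> is determined by the past,
  hence independent of the next increment, which Fubini integrates out. Testing against sets of the
  past is the form that the induction over grid points consumes.\<close>

lemma markov:
  assumes \<phi>: "bounded_measurable \<phi>" and A: "A \<in> sets (past s)" and s: "0 \<le> s" and t: "0 \<le> t"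
  shows "(\<integral>\<omega>. indicator A \<omega> * \<phi> (X (s + t) \<omega>) \<partial>M) = (\<integral>\<omega>. indicator A \<omega> * drift_op lam t \<phi> (X s \<omega>) \<partial>M)"
proof (cases "t = 0")
  case False
  with t have t: "0 < t" by simp
  note [measurable] = bounded_measurable_measurable[OF \<phi>]
  obtain C where C: "\<And>x. \<bar>\<phi> x\<bar> \<le> C" using \<phi> by (metis bounded_measurableE)
  define D where "D = (\<lambda>\<omega>. B (s + t) \<omega> - B s \<omega>)"
  \<comment> \<open>\<open>indep_var\<close> requires both variables to have the same type of
    values; the second coordinate is a dummy that matches the type of \<open>Z\<close>.\<close>
  define Y where "Y = (\<lambda>\<omega>. (D \<omega>, 0::real))"
  define Z where "Z = (\<lambda>\<omega>. (indicator A \<omega> :: real, X s \<omega>))"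
  have [measurable]: "D \<in> borel_measurable M"
    unfolding D_def using s t by (intro borel_measurable_diff B_measurable) auto
  have Y [measurable]: "Y \<in> M \<rightarrow>\<^sub>M borel"
    unfolding Y_def by measurable
  have Zp: "Z \<in> past s \<rightarrow>\<^sub>M borel"
    unfolding Z_def using A X_past[of s s] s by measurable
  then have Z [measurable]: "Z \<in> M \<rightarrow>\<^sub>M borel"
    by (rule measurable_past)
  have "indep_var borel Z borel Y"
    unfolding indep_var_eq
  proof (intro conjI Z Y)
    have 1: "sigma_sets (space M) {Z -` E \<inter> space M | E. E \<in> sets borel} \<subseteq> sets (past s)"
    proof -
      have "{Z -` E \<inter> space M | E. E \<in> sets borel} \<subseteq> sets (past s)"
        using measurable_sets[OF Zp] by auto
      from sets.sigma_sets_subset[OF this] show ?thesis by simp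
    qed
    have 2: "sigma_sets (space M) {Y -` E \<inter> space M | E. E \<in> sets borel} \<subseteq>
        sigma_sets (space M) {D -` E \<inter> space M | E. E \<in> sets borel}"
    proof (rule sigma_sets_mono', safe)
      fix E :: "(real \<times> real) set" assume [measurable]: "E \<in> sets borel"
      have "(\<lambda>x::real. (x, 0::real)) -` E \<inter> space borel \<in> sets borel"
        by measurable
      then show "\<exists>F. Y -` E \<inter> space M = D -` F \<inter> space M \<and> F \<in> sets borel"
        by (intro exI[of _ "(\<lambda>x. (x, 0)) -` E"]) (auto simp: Y_def)
    qed
    show "indep_set (sigma_sets (space M) {Z -` E \<inter> space M | E. E \<in> sets borel})
        (sigma_sets (space M) {Y -` E \<inter> space M | E. E \<in> sets borel})"
      using past_indep_increment[OF s t] 1 2 unfolding indep_sets2_eq D_def[symmetric]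
      by (meson order_trans subset_iff)
  qed
  then have distr: "distr M borel Z \<Otimes>\<^sub>M distr M borel Y = distr M (borel \<Otimes>\<^sub>M borel) (\<lambda>\<omega>. (Z \<omega>, Y \<omega>))"
    unfolding indep_var_distribution_eq by blast
  interpret DZ: prob_space "distr M borel Z" by (rule prob_space_distr) measurable
  interpret DY: prob_space "distr M borel Y" by (rule prob_space_distr) measurable
  interpret DD: pair_prob_space "distr M borel Z" "distr M borel Y" ..
  have [measurable]: "(fst :: real \<times> real \<Rightarrow> real) \<in> borel_measurable borel"
    "(snd :: real \<times> real \<Rightarrow> real) \<in> borel_measurable borel"
    by (intro borel_measurable_continuous_onI continuous_intros)+
  \<comment> \<open>Clamping the first coordinate to the unit interval leaves indicators unchanged
    and makes \<open>F\<close> bounded everywhere.\<close>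
  define F where "F p = max 0 (min 1 (fst (fst p))) * \<phi> (snd (fst p) + lam * t + fst (snd p))"
    for p :: "(real \<times> real) \<times> real \<times> real"
  have [measurable]: "F \<in> borel_measurable (borel \<Otimes>\<^sub>M borel)"
    unfolding F_def by measurable
  have "\<bar>F p\<bar> \<le> 1 * C" for p
    unfolding F_def abs_mult using C by (intro mult_mono) auto
  then have int: "integrable (distr M borel Z \<Otimes>\<^sub>M distr M borel Y) F"
    by (intro DD.integrable_const_bound[where B=C]) auto
  have "(\<integral>\<omega>. indicator A \<omega> * \<phi> (X (s + t) \<omega>) \<partial>M) = (\<integral>\<omega>. F (Z \<omega>, Y \<omega>) \<partial>M)"
    by (intro Bochner_Integration.integral_cong) (auto simp: F_def Z_def Y_def D_def X_add indicator_def)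
  also have "\<dots> = (\<integral>p. F p \<partial>distr M (borel \<Otimes>\<^sub>M borel) (\<lambda>\<omega>. (Z \<omega>, Y \<omega>)))"
    by (rule integral_distr[symmetric]) measurable
  also have "\<dots> = (\<integral>z. \<integral>y. F (z, y) \<partial>distr M borel Y \<partial>distr M borel Z)"
    unfolding distr[symmetric] by (rule DD.integral_fst'[OF int, symmetric])
  also have "\<dots> = (\<integral>z. max 0 (min 1 (fst z)) * drift_op lam t \<phi> (snd z) \<partial>distr M borel Z)"
  proof (intro Bochner_Integration.integral_cong refl)
    fix z
    have "(\<integral>y. F (z, y) \<partial>distr M borel Y) = (\<integral>\<omega>. F (z, Y \<omega>) \<partial>M)"
      by (rule integral_distr) measurable
    also have "\<dots> = max 0 (min 1 (fst z)) * (\<integral>\<omega>. \<phi> (snd z + lam * t + D \<omega>) \<partial>M)"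
      by (simp add: F_def Y_def)
    also have "(\<integral>\<omega>. \<phi> (snd z + lam * t + D \<omega>) \<partial>M) = drift_op lam t \<phi> (snd z)"
      unfolding D_def by (rule drift_op_distributed[OF _ t increment_distributed[OF s t]]) measurable
    finally show "(\<integral>y. F (z, y) \<partial>distr M borel Y) = max 0 (min 1 (fst z)) * drift_op lam t \<phi> (snd z)" .
  qed
  also have "\<dots> = (\<integral>\<omega>. max 0 (min 1 (fst (Z \<omega>))) * drift_op lam t \<phi> (snd (Z \<omega>)) \<partial>M)"
    by (rule integral_distr) measurable
  also have "\<dots> = (\<integral>\<omega>. indicator A \<omega> * drift_op lam t \<phi> (X s \<omega>) \<partial>M)"
    by (intro Bochner_Integration.integral_cong) (auto simp: Z_def indicator_def)
  finally show ?thesis .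
qed simp

end

section \<open>The probability of reaching a level\<close>

text \<open>First-step recursion for the probability that the motion started at \<open>x\<close> and
  sampled at times \<open>0, d, ..., n * d\<close> has a value at or below \<open>z\<close>;
  \<open>prob_reaches_grid\<close> justifies this reading.\<close>

primrec grid_hit :: "real \<Rightarrow> real \<Rightarrow> real \<Rightarrow> nat \<Rightarrow> real \<Rightarrow> real" where
  "grid_hit lam z d 0 x = indicator {..z} x"
| "grid_hit lam z d (Suc n) x = (if x \<le> z then 1 else drift_op lam d (grid_hit lam z d n) x)"

lemma grid_hit_measurable [measurable]: "grid_hit lam z d n \<in> borel_measurable borel"
proof (induction n)
  case (Suc n)
  note [measurable] = Suc
  have "grid_hit lam z d (Suc n) = (\<lambda>x. if x \<le> z then 1 else drift_op lam d (grid_hit lam z d n) x)"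
    by auto
  then show ?case by simp
next
  case 0
  have "grid_hit lam z d 0 = indicator {..z}"
    by auto
  then show ?case by simp
qed

lemma grid_hit_bounds: "0 \<le> grid_hit lam z d n x \<and> grid_hit lam z d n x \<le> 1"
proof (induction n arbitrary: x)
  case (Suc n)
  have bm: "bounded_measurable (grid_hit lam z d n)"
    using Suc by (intro bounded_measurableI[where C=1]) auto
  have "drift_op lam d (\<lambda>_. 0) x \<le> drift_op lam d (grid_hit lam z d n) x"
    "drift_op lam d (grid_hit lam z d n) x \<le> drift_op lam d (\<lambda>_. 1) x"
    using Suc by (intro drift_op_mono bm bounded_measurable_const; simp)+
  then show ?case by simp
qed (simp add: indicator_def)

lemma bounded_measurable_grid_hit: "bounded_measurable (grid_hit lam z d n)"
  using grid_hit_bounds[of lam z d n] by (intro bounded_measurableI[where C=1]) auto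

text \<open>\<open>visit_prob\<close> is excessive: above \<open>z\<close> the reversed drift gives
  it as the exponential times an average of a function bounded by 1. It equals 1 below
  \<open>z\<close>, so it dominates the recursion.\<close>

lemma grid_hit_le_visit_prob:
  assumes lam: "lam > 0" and d: "d \<ge> 0"
  shows "grid_hit lam z d n x \<le> visit_prob lam z x"
proof (induction n arbitrary: x)
  case (Suc n)
  have "drift_op lam d (grid_hit lam z d n) x \<le> visit_prob lam z x" if "x > z"
  proof -
    have "drift_op lam d (grid_hit lam z d n) x \<le> drift_op lam d (visit_prob lam z) x"
      by (intro drift_op_mono Suc bounded_measurable_grid_hit bounded_measurable_visit_prob lam)
    also have "\<dots> = exp (- 2 * lam * (x - z)) * drift_op (- lam) d (visit_prob_dual lam z) x"
      using drift_op_visit_prob_dual[of "\<lambda>_. 1" d lam z x] d by simp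
    also have "drift_op (- lam) d (visit_prob_dual lam z) x \<le> drift_op (- lam) d (\<lambda>_. 1) x"
      by (intro drift_op_mono bounded_measurable_visit_prob_dual bounded_measurable_const visit_prob_dual_le_1 lam)
    finally show ?thesis
      using that by (simp add: visit_prob_eq)
  qed
  then show ?case
    by (auto simp: visit_prob_eq)
qed (auto simp: visit_prob_eq indicator_def)

text \<open>Here \<open>\<eta>\<close> bounds the probability, under the reversed drift, that a single step overshoots the
  level by more than \<open>e\<close>; stating the bound down to \<open>z - e\<close> is what makes the induction close.\<close>

lemma grid_hit_ge:
  assumes lam: "lam > 0" and d: "d \<ge> 0" and e: "e > 0" and x: "x \<ge> z - e"
  defines "\<eta> \<equiv> drift_op (- lam) d (indicator {..- e}) 0"
  shows "exp (- 2 * lam * (x - z)) * (drift_op (- lam) (real n * d) (indicator {..z}) x - real n * \<eta>)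
    \<le> exp (2 * lam * e) * grid_hit lam z d n x"
  using x
proof (induction n arbitrary: x)
  case 0
  have "exp (- 2 * lam * (x - z)) \<le> exp (2 * lam * e)"
    using lam mult_left_mono[OF 0, of "2 * lam"] by (simp add: algebra_simps)
  then show ?case
    by (auto simp: indicator_def)
next
  case (Suc n)
  let ?G = "\<lambda>n. drift_op (- lam) (real n * d) (indicator {..z})"
  have bmG: "bounded_measurable (?G n)" for n
    by (intro bounded_measurable_drift_op bounded_measurable_indicator) auto
  have G: "?G n x \<le> 1" for n x
    using drift_op_abs_le[of "indicator {..z}" 1 "- lam" "real n * d" x] bounded_measurable_indicator[of "{..z}"]
    by (auto simp: indicator_def)
  have \<eta>: "\<eta> \<ge> 0"
    unfolding \<eta>_def drift_op_def by (intro integral_nonneg_AE) auto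
  show ?case
  proof (cases "x \<le> z")
    case True
    have "exp (- 2 * lam * (x - z)) * (?G (Suc n) x - real (Suc n) * \<eta>) \<le> exp (- 2 * lam * (x - z)) * 1"
      using G[of "Suc n" x] mult_nonneg_nonneg[OF of_nat_0_le_iff[of "Suc n"] \<eta>] by (intro mult_left_mono) auto
    also have "\<dots> \<le> exp (2 * lam * e)"
      using lam mult_left_mono[OF Suc.prems, of "2 * lam"] by (simp add: algebra_simps)
    finally show ?thesis
      using True by simp
  next
    case False
    \<comment> \<open>The lower bound from the induction hypothesis, cut off where that hypothesis
      is silent and freed of \<open>exp (- 2 * lam * y)\<close>, so that
      \<open>drift_op_tilt\<close> applies.\<close>
    define \<psi> where "\<psi> y = exp (2 * lam * z) * (indicator {z - e..} y * (?G n y - real n * \<eta>))" for y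
    have [measurable]: "\<psi> \<in> borel_measurable borel"
      unfolding \<psi>_def by (intro borel_measurable_times borel_measurable_diff
        bounded_measurable_measurable[OF bmG]) auto
    have \<psi>_le: "exp (- 2 * lam * y) * \<psi> y \<le> exp (2 * lam * e) * grid_hit lam z d n y" for y
    proof (cases "y \<ge> z - e")
      case True
      have "exp (- 2 * lam * y) * \<psi> y = exp (- 2 * lam * (y - z)) * (?G n y - real n * \<eta>)"
        using True by (simp add: \<psi>_def algebra_simps flip: exp_add)
      then show ?thesis
        using Suc.IH[OF True] by simp
    qed (use grid_hit_bounds[of lam z d n y] in \<open>auto simp: \<psi>_def\<close>)
    have bm\<psi>: "bounded_measurable (\<lambda>y. exp (- 2 * lam * y) * \<psi> y)"
    proof (rule bounded_measurableI[where C="exp (2 * lam * e) * (1 + real n * \<eta>)"])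
      fix y
      have "\<bar>?G n y\<bar> \<le> 1"
        by (rule drift_op_abs_le) (auto intro: bounded_measurable_indicator simp: indicator_def)
      then have "\<bar>?G n y - real n * \<eta>\<bar> \<le> 1 + real n * \<eta>"
        using mult_nonneg_nonneg[OF of_nat_0_le_iff[of n] \<eta>] by (simp only: abs_le_iff) linarith
      moreover have "exp (- 2 * lam * y) * exp (2 * lam * z) \<le> exp (2 * lam * e)" if "y \<ge> z - e"
        using lam mult_left_mono[OF that, of "2 * lam"] by (simp add: algebra_simps flip: exp_add)
      ultimately show "\<bar>exp (- 2 * lam * y) * \<psi> y\<bar> \<le> exp (2 * lam * e) * (1 + real n * \<eta>)"
        using \<eta> by (auto simp: \<psi>_def abs_mult indicator_def mult.assoc[symmetric] intro!: mult_mono)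
    qed measurable
    \<comment> \<open>Since \<open>x > z\<close>, landing below \<open>z - e\<close> takes a step of
      at most \<open>- e\<close>.\<close>
    have jump: "drift_op (- lam) d (indicator {..<z - e}) x \<le> \<eta>"
      unfolding \<eta>_def drift_op_def using False
      by (intro integral_mono std_normal.integrable_bounded_measurable bounded_measurable_indicator)
         (auto simp: indicator_def)
    have ee: "exp (- 2 * lam * (x - z)) = exp (- 2 * lam * x) * exp (2 * lam * z)"
      by (simp add: algebra_simps flip: exp_add)
    have "?G (Suc n) x - real (Suc n) * \<eta> \<le> drift_op (- lam) d (?G n) x + - (real n * \<eta>) + (-1) * drift_op (- lam) d (indicator {..<z - e}) x"
    proof -
      have "drift_op (- lam) d (?G n) x = ?G (Suc n) x"
        using d by (subst drift_op_semigroup) (auto intro!: bounded_measurable_indicator simp: algebra_simps)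
      then show ?thesis
        using jump by (simp add: algebra_simps)
    qed
    also have "\<dots> = drift_op (- lam) d (\<lambda>y. ?G n y + - (real n * \<eta>) + (-1) * indicator {..<z - e} y) x"
    proof -
      have "bounded_measurable (\<lambda>y. (-1) * indicator {..<z - e} y)"
        by (intro bounded_measurable_mult bounded_measurable_const bounded_measurable_indicator) auto
      then show ?thesis
        by (simp only: drift_op_add drift_op_cmult drift_op_const bounded_measurable_add bmG bounded_measurable_const)
    qed
    also have "\<dots> \<le> drift_op (- lam) d (\<lambda>y. indicator {z - e..} y * (?G n y - real n * \<eta>)) x"
    proof (intro drift_op_mono bounded_measurable_add bounded_measurable_mult bmG bounded_measurable_const bounded_measurable_indicator)
      show "bounded_measurable (\<lambda>y. ?G n y - real n * \<eta>)"
        using bounded_measurable_add[OF bmG bounded_measurable_const[of "- (real n * \<eta>)"]] by simp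
      \<comment> \<open>The cut-off discards a quantity of at most 1 below \<open>z - e\<close>; the
        subtracted indicator pays for it.\<close>
      show "?G n y + - (real n * \<eta>) + (-1) * indicator {..<z - e} y \<le> indicator {z - e..} y * (?G n y - real n * \<eta>)" for y
        using G[of n y] mult_nonneg_nonneg[OF of_nat_0_le_iff[of n] \<eta>] by (auto simp: indicator_def)
    qed auto
    finally have "exp (- 2 * lam * (x - z)) * (?G (Suc n) x - real (Suc n) * \<eta>) \<le>
        exp (- 2 * lam * x) * (exp (2 * lam * z) * drift_op (- lam) d (\<lambda>y. indicator {z - e..} y * (?G n y - real n * \<eta>)) x)"
      unfolding ee mult.assoc[of "exp _" "exp _"] by (intro mult_left_mono) auto
    also have "\<dots> = exp (- 2 * lam * x) * drift_op (- lam) d \<psi> x"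
      unfolding \<psi>_def by (simp add: drift_op_cmult)
    also have "\<dots> = drift_op lam d (\<lambda>y. exp (- 2 * lam * y) * \<psi> y) x"
      using d by (intro drift_op_tilt[symmetric]) auto
    also have "\<dots> \<le> drift_op lam d (\<lambda>y. exp (2 * lam * e) * grid_hit lam z d n y) x"
      by (intro drift_op_mono bm\<psi> \<psi>_le bounded_measurable_mult bounded_measurable_const bounded_measurable_grid_hit)
    finally show ?thesis
      using False by (simp add: drift_op_cmult)
  qed
qed

text \<open>The drift accounts for at most \<open>e / 2\<close>, so the Gaussian part must account
  for the other half; Markov's inequality with the fourth moment 3 gives \<open>3 * 16 = 48\<close>.
  Order \<open>d\<^sup>2\<close> matters: summed over \<open>m * 2 ^ m\<close> steps of length
  \<open>(1/2) ^ m\<close> it vanishes, whereas a second-moment bound of order \<open>d\<close>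
  would sum to order \<open>m\<close>.\<close>

lemma drift_op_jump_le:
  assumes d: "d > 0" and e: "2 * lam * d \<le> e"  and e_pos: "e > 0"
  shows "drift_op (- lam) d (indicator {..- e}) 0 \<le> 48 / e ^ 4 * d\<^sup>2"
proof -
  have int: "integrable std_normal_distribution (\<lambda>w. w ^ 4)"
    using integrable_std_normal_moment[of 4] by (subst integrable_density) auto
  have "(\<integral>w. w ^ 4 \<partial>std_normal_distribution) = (\<integral>w. std_normal_density w * w ^ 4 \<partial>lborel)"
    by (subst integral_density) auto
  also have "\<dots> = 3"
    using integral_std_normal_moment_even[of 2] by (simp add: fact_numeral)
  finally have moment: "(\<integral>w. w ^ 4 \<partial>std_normal_distribution) = 3" .
  have "drift_op (- lam) d (indicator {..- e}) 0 \<le> (\<integral>w. 16 / e ^ 4 * d\<^sup>2 * w ^ 4 \<partial>std_normal_distribution)"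
    unfolding drift_op_def
  proof (rule integral_mono[OF std_normal.integrable_const_bound[where B=1] integrable_mult_right[OF int]])
    fix w
    show "indicator {..- e} (0 + - lam * d + sqrt d * w) \<le> 16 / e ^ 4 * d\<^sup>2 * w ^ 4"
    proof (cases "0 + - lam * d + sqrt d * w \<le> - e")
      case True
      then have "e \<le> 2 * (sqrt d * (- w))"
        using e by simp
      then have "e ^ 4 \<le> (2 * (sqrt d * (- w))) ^ 4"
        using e_pos by (intro power_mono) auto
      also have "\<dots> = 16 * ((sqrt d)\<^sup>2)\<^sup>2 * w ^ 4"
        by (simp add: power_mult_distrib flip: power_mult)
      also have "\<dots> = 16 * d\<^sup>2 * w ^ 4"
        using d by simp
      finally show ?thesis
        using True e_pos by (simp add: field_simps)
    qed simp
  qed auto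
  also have "\<dots> = 48 / e ^ 4 * d\<^sup>2"
    using moment by simp
  finally show ?thesis .
qed

lemma drift_eventually_gt:
  fixes lam w x z :: real
  assumes lam: "lam > 0"
  shows "\<forall>\<^sub>F m in sequentially. x + lam * real m + sqrt (real m) * w > z"
proof -
  have "filterlim (\<lambda>m. sqrt (real m)) at_top sequentially"
    by (intro filterlim_compose[OF sqrt_at_top filterlim_real_sequentially])
  \<comment> \<open>The threshold makes \<open>lam * sqrt m + w\<close> at least
    \<open>\<bar>x - z\<bar> + 1\<close>; multiplying by \<open>sqrt m \<ge> 1\<close> preserves
    that bound.\<close>
  then have "\<forall>\<^sub>F m in sequentially. sqrt (real m) \<ge> max 1 ((\<bar>w\<bar> + \<bar>x - z\<bar> + 1) / lam)"
    unfolding filterlim_at_top by blast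
  then show ?thesis
  proof eventually_elim
    case (elim m)
    then have s: "sqrt (real m) \<ge> 1" and "lam * sqrt (real m) \<ge> \<bar>w\<bar> + \<bar>x - z\<bar> + 1"
      using lam by (auto simp: field_simps)
    then have "lam * sqrt (real m) + w \<ge> \<bar>x - z\<bar> + 1"
      by linarith
    then have "sqrt (real m) * (lam * sqrt (real m) + w) \<ge> 1 * (\<bar>x - z\<bar> + 1)"
      using s by (intro mult_mono) auto
    moreover have "sqrt (real m) * (lam * sqrt (real m) + w) = lam * real m + sqrt (real m) * w"
      by (simp add: algebra_simps flip: real_sqrt_mult)
    ultimately have "\<bar>x - z\<bar> + 1 \<le> lam * real m + sqrt (real m) * w"
      by simp
    then show ?case by linarith
  qed
qed

lemma drift_op_up_LIMSEQ:
  assumes "lam > 0"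
  shows "(\<lambda>m. drift_op lam (real m) (indicator {..z}) x) \<longlonglongrightarrow> 0"
proof (rule drift_op_LIMSEQ_const[where C=1])
  fix w
  show "(\<lambda>m. indicator {..z} (x + lam * real m + sqrt (real m) * w) :: real) \<longlonglongrightarrow> 0"
    using drift_eventually_gt[OF assms, of z x w]
    by (intro tendsto_eventually) (auto elim!: eventually_mono simp: indicator_def)
qed (auto simp: indicator_def)

lemma drift_op_down_LIMSEQ:
  assumes "lam > 0"
  shows "(\<lambda>m. drift_op (- lam) (real m) (indicator {..z}) x) \<longlonglongrightarrow> 1"
proof (rule drift_op_LIMSEQ_const[where C=1])
  fix w
  show "(\<lambda>m. indicator {..z} (x + - lam * real m + sqrt (real m) * w) :: real) \<longlonglongrightarrow> 1"
    using drift_eventually_gt[OF assms, of "- z" "- x" "- w"]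
    by (intro tendsto_eventually) (auto elim!: eventually_mono simp: indicator_def)
qed (auto simp: indicator_def)

text \<open>The upper bound holds for every \<open>m\<close>. For the lower one the horizon
  \<open>m\<close> must grow so that the reversed motion ends below \<open>z\<close>, while the
  total overshoot error stays of order \<open>m * (1/2) ^ m\<close>. The tolerance \<open>e\<close>
  is fixed before \<open>m\<close> and costs only the factor
  \<open>exp (- 2 * lam * e)\<close>.\<close>

lemma grid_hit_LIMSEQ:
  assumes lam: "lam > 0"
  shows "(\<lambda>m. grid_hit lam z ((1/2) ^ m) (m * 2 ^ m) x) \<longlonglongrightarrow> visit_prob lam z x"
proof (cases "x \<le> z")
  case True
  have "grid_hit lam z d n x = 1" for d n
    using True by (cases n) auto
  then show ?thesis
    using True by (simp add: visit_prob_eq)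
next
  case False
  let ?q = "\<lambda>m. grid_hit lam z ((1/2) ^ m) (m * 2 ^ m) x" and ?g = "visit_prob lam z x"
  let ?G = "\<lambda>m. drift_op (- lam) (real m) (indicator {..z}) x"
  show ?thesis
  proof (rule order_tendstoI)
    fix a assume "a > ?g"
    then show "\<forall>\<^sub>F m in sequentially. ?q m < a"
      using grid_hit_le_visit_prob[OF lam] by (intro always_eventually allI) (meson le_less_trans zero_le_divide_1_iff zero_le_numeral zero_le_power)
  next
    fix a assume a: "a < ?g"
    have "((\<lambda>e. exp (- 2 * lam * e) * ?g) \<longlongrightarrow> exp (- 2 * lam * 0) * ?g) (at_right 0)"
      by (intro tendsto_intros)
    then have "\<forall>\<^sub>F e in at_right 0. a < exp (- 2 * lam * e) * ?g"
      using a by (intro order_tendstoD) auto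
    then have "\<forall>\<^sub>F e in at_right (0::real). a < exp (- 2 * lam * e) * ?g \<and> e > 0"
      using eventually_at_right_less by (rule eventually_conj)
    then obtain e where e: "e > 0" "a < exp (- 2 * lam * e) * ?g"
      using eventually_happens[of _ "at_right (0::real)"] by auto
    have "(\<lambda>m. real m * (1/2) ^ m) \<longlonglongrightarrow> 0"
      using powser_times_n_limit_0[of "1/2 :: real"] by simp
    then have lim: "(\<lambda>m. exp (- 2 * lam * e) * ?g * (?G m - 48 / e ^ 4 * (real m * (1/2) ^ m)))
        \<longlonglongrightarrow> exp (- 2 * lam * e) * ?g * (1 - 48 / e ^ 4 * 0)"
      by (intro tendsto_intros drift_op_down_LIMSEQ lam)
    have "(\<lambda>m. 2 * lam * (1/2) ^ m) \<longlonglongrightarrow> 2 * lam * 0"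
      by (intro tendsto_intros LIMSEQ_power_zero) simp
    then have "\<forall>\<^sub>F m in sequentially. 2 * lam * (1/2) ^ m < e"
      using e by (intro order_tendstoD) auto
    moreover have "\<forall>\<^sub>F m in sequentially. a < exp (- 2 * lam * e) * ?g * (?G m - 48 / e ^ 4 * (real m * (1/2) ^ m))"
      using e by (intro order_tendstoD[OF lim]) auto
    ultimately show "\<forall>\<^sub>F m in sequentially. a < ?q m"
    proof eventually_elim
      case (elim m)
      let ?\<eta> = "drift_op (- lam) ((1/2) ^ m) (indicator {..- e}) 0"
      have \<eta>: "?\<eta> \<le> 48 / e ^ 4 * ((1/2) ^ m)\<^sup>2"
        using elim e by (intro drift_op_jump_le) auto
      have nd: "real (m * 2 ^ m) * (1/2) ^ m = real m" "real (m * 2 ^ m) * ((1/2) ^ m)\<^sup>2 = real m * (1/2) ^ m"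
        by (simp_all add: power_one_over power2_eq_square field_simps)
      have "real (m * 2 ^ m) * ?\<eta> \<le> real (m * 2 ^ m) * (48 / e ^ 4 * ((1/2) ^ m)\<^sup>2)"
        by (intro mult_left_mono \<eta>) simp
      also have "\<dots> = 48 / e ^ 4 * (real (m * 2 ^ m) * ((1/2) ^ m)\<^sup>2)"
        by (simp only: mult_ac)
      finally have \<eta>: "real (m * 2 ^ m) * ?\<eta> \<le> 48 / e ^ 4 * (real m * (1/2) ^ m)"
        unfolding nd .
      have "?g * (?G m - 48 / e ^ 4 * (real m * (1/2) ^ m)) \<le> ?g * (?G m - real (m * 2 ^ m) * ?\<eta>)"
        using \<eta> by (intro mult_left_mono) (auto simp: less_imp_le)
      also have "\<dots> \<le> exp (2 * lam * e) * ?q m"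
        using grid_hit_ge[OF lam _ e(1), of "(1/2) ^ m" z x "m * 2 ^ m"] False e(1)
        unfolding nd by (simp add: visit_prob_eq)
      finally have "exp (- 2 * lam * e) * (?g * (?G m - 48 / e ^ 4 * (real m * (1/2) ^ m))) \<le>
          exp (- 2 * lam * e) * (exp (2 * lam * e) * ?q m)"
        by (intro mult_left_mono) auto
      moreover have "exp (- 2 * lam * e) * (exp (2 * lam * e) * ?q m) = ?q m"
        by (simp add: mult.assoc[symmetric] flip: exp_add)
      ultimately show ?case
        using elim(2) by (simp only: mult.assoc)
    qed
  qed
qed

section \<open>Visits observed along dyadic grids\<close>

context brownian_motion begin

definition reaches_grid :: "real \<Rightarrow> real \<Rightarrow> real \<Rightarrow> nat \<Rightarrow> 'a set" where
  "reaches_grid z u d n = {\<omega>\<in>space M. \<exists>k\<le>n. X (u + real k * d) \<omega> \<le> z}"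

text \<open>A measurable substitute for a visit to \<open>z\<close> after time \<open>u\<close>:
  countably many times are inspected, and equality is relaxed to an inequality. Path regularity
  reconciles the two almost surely.\<close>

definition reaches :: "real \<Rightarrow> real \<Rightarrow> 'a set" where
  "reaches z u = (\<Union>m. reaches_grid z u ((1/2) ^ m) (m * 2 ^ m))"

lemma reaches_grid_events [measurable]:
  assumes "u \<ge> 0" "d \<ge> 0" shows "reaches_grid z u d n \<in> events"
proof -
  have "{\<omega>\<in>space M. X (u + real k * d) \<omega> \<le> z} \<in> events" for k
  proof -
    have [measurable]: "X (u + real k * d) \<in> borel_measurable M"
      using assms by (intro X_measurable) auto
    show ?thesis by measurable
  qed
  then have "(\<Union>k\<in>{..n}. {\<omega>\<in>space M. X (u + real k * d) \<omega> \<le> z}) \<in> events"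
    by (intro sets.finite_UN) auto
  also have "(\<Union>k\<in>{..n}. {\<omega>\<in>space M. X (u + real k * d) \<omega> \<le> z}) = reaches_grid z u d n"
    by (auto simp: reaches_grid_def)
  finally show ?thesis .
qed

lemma reaches_mono: "z \<le> y \<Longrightarrow> reaches z u \<subseteq> reaches y u"
  unfolding reaches_def reaches_grid_def by (intro UN_mono Collect_mono) (auto dest: order_trans)

lemma reaches_events [measurable]: "u \<ge> 0 \<Longrightarrow> reaches z u \<in> events"
  unfolding reaches_def by (intro sets.countable_UN) auto

lemma reaches_grid_Suc:
  "reaches_grid z u d (Suc n) = {\<omega>\<in>space M. X u \<omega> \<le> z} \<union> reaches_grid z (u + d) d n"
proof -
  have "(\<exists>k\<le>Suc n. X (u + real k * d) \<omega> \<le> z) \<longleftrightarrow> X u \<omega> \<le> z \<or> (\<exists>k\<le>n. X (u + d + real k * d) \<omega> \<le> z)" for \<omega>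
  proof -
    have "(\<exists>k\<le>Suc n. P k) \<longleftrightarrow> P 0 \<or> (\<exists>k\<le>n. P (Suc k))" for P
      by (metis Suc_le_mono not0_implies_Suc zero_le)
    then show ?thesis
      by (simp add: algebra_simps)
  qed
  then show ?thesis
    by (auto simp: reaches_grid_def)
qed

lemma integrable_indicator_mult:
  assumes "A \<in> events" "bounded_measurable \<phi>" "Y \<in> borel_measurable M"
  shows "integrable M (\<lambda>\<omega>. indicator A \<omega> * \<phi> (Y \<omega>))"
  using integrable_real_mult_indicator[OF assms(1) integrable_bounded_measurable[OF assms(2,3)]]
  by (simp add: mult.commute)

text \<open>\<open>A\<close> and \<open>u\<close> vary in the induction: the event of still being
  above \<open>z\<close> at time \<open>u\<close> is absorbed into \<open>A\<close>, which then
  belongs to the past at the next grid point.\<close>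

lemma prob_reaches_grid:
  assumes "A \<in> sets (past u)" "u \<ge> 0" "d \<ge> 0"
  shows "prob (A \<inter> reaches_grid z u d n) = (\<integral>\<omega>. indicator A \<omega> * grid_hit lam z d n (X u \<omega>) \<partial>M)"
  using assms
proof (induction n arbitrary: A u)
  case 0
  have A: "A \<in> events"
    using 0 sets_past_subset by blast
  have "prob (A \<inter> reaches_grid z u d 0) = (\<integral>\<omega>. indicator (A \<inter> reaches_grid z u d 0) \<omega> \<partial>M)"
    using A 0 by (subst Bochner_Integration.integral_indicator) (auto simp: Int_absorb2 sets.sets_into_space)
  also have "\<dots> = (\<integral>\<omega>. indicator A \<omega> * grid_hit lam z d 0 (X u \<omega>) \<partial>M)"
    by (intro Bochner_Integration.integral_cong) (auto simp: reaches_grid_def indicator_def)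
  finally show ?case .
next
  case (Suc n)
  note u = \<open>u \<ge> 0\<close> and d = \<open>d \<ge> 0\<close>
  let ?B = "{\<omega>\<in>space M. X u \<omega> \<le> z}"
  have A [measurable]: "A \<in> events"
    using Suc sets_past_subset by blast
  have B: "?B \<in> sets (past u)"
    using measurable_sets[OF X_past[OF u order_refl], of "{..z}"] by (simp add: vimage_def Int_def conj_commute)
  then have AB: "A - ?B \<in> sets (past u)"
    using Suc.prems by auto
  have [measurable]: "?B \<in> events"
    using u by measurable
  have ABd: "A - ?B \<in> sets (past (u + d))"
    using AB sets_past_mono[of u "u + d"] d by auto
  have "A \<inter> reaches_grid z u d (Suc n) = (A \<inter> ?B) \<union> ((A - ?B) \<inter> reaches_grid z (u + d) d n)"
    unfolding reaches_grid_Suc using sets.sets_into_space[OF A] by auto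
  then have "prob (A \<inter> reaches_grid z u d (Suc n)) = prob (A \<inter> ?B) + prob ((A - ?B) \<inter> reaches_grid z (u + d) d n)"
    using u d by (simp only:, intro finite_measure_Union) auto
  also have "prob ((A - ?B) \<inter> reaches_grid z (u + d) d n) =
      (\<integral>\<omega>. indicator (A - ?B) \<omega> * grid_hit lam z d n (X (u + d) \<omega>) \<partial>M)"
    using u d by (intro Suc.IH ABd) auto
  also have "\<dots> = (\<integral>\<omega>. indicator (A - ?B) \<omega> * drift_op lam d (grid_hit lam z d n) (X u \<omega>) \<partial>M)"
    by (intro markov bounded_measurable_grid_hit AB u d)
  also have "prob (A \<inter> ?B) = (\<integral>\<omega>. indicator (A \<inter> ?B) \<omega> * (\<lambda>_. 1) (X u \<omega>) \<partial>M)"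
    by (simp add: Int_absorb2)
  also have "(\<integral>\<omega>. indicator (A \<inter> ?B) \<omega> * (\<lambda>_. 1) (X u \<omega>) \<partial>M) +
      (\<integral>\<omega>. indicator (A - ?B) \<omega> * drift_op lam d (grid_hit lam z d n) (X u \<omega>) \<partial>M) =
      (\<integral>\<omega>. indicator (A \<inter> ?B) \<omega> * (\<lambda>_. 1) (X u \<omega>) +
        indicator (A - ?B) \<omega> * drift_op lam d (grid_hit lam z d n) (X u \<omega>) \<partial>M)"
    using u by (intro Bochner_Integration.integral_add[symmetric] integrable_indicator_mult[where Y="X u"]
      bounded_measurable_const bounded_measurable_drift_op bounded_measurable_grid_hit) auto
  also have "\<dots> = (\<integral>\<omega>. indicator A \<omega> * grid_hit lam z d (Suc n) (X u \<omega>) \<partial>M)"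
    by (intro Bochner_Integration.integral_cong) (auto simp: indicator_def)
  finally show ?case .
qed

lemma incseq_reaches_grid: "incseq (\<lambda>m. reaches_grid z u ((1/2) ^ m) (m * 2 ^ m))"
proof (rule incseq_SucI, rule subsetI)
  fix m \<omega> assume "\<omega> \<in> reaches_grid z u ((1/2) ^ m) (m * 2 ^ m)"
  then obtain k where k: "\<omega> \<in> space M" "k \<le> m * 2 ^ m" "X (u + real k * (1/2) ^ m) \<omega> \<le> z"
    by (auto simp: reaches_grid_def)
  have "X (u + real (2 * k) * (1/2) ^ Suc m) \<omega> \<le> z" "2 * k \<le> Suc m * 2 ^ Suc m"
    using k by (auto simp: field_simps)
  then show "\<omega> \<in> reaches_grid z u ((1/2) ^ Suc m) (Suc m * 2 ^ Suc m)"
    using k(1) unfolding reaches_grid_def by blast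
qed

lemma prob_reaches:
  assumes A: "A \<in> sets (past u)" and u: "u \<ge> 0"
  shows "prob (A \<inter> reaches z u) = (\<integral>\<omega>. indicator A \<omega> * visit_prob lam z (X u \<omega>) \<partial>M)"
proof -
  have A' [measurable]: "A \<in> events"
    using A sets_past_subset by blast
  let ?R = "\<lambda>m. reaches_grid z u ((1/2) ^ m) (m * 2 ^ m)"
  have "(\<lambda>m. prob (A \<inter> ?R m)) \<longlonglongrightarrow> prob (\<Union>m. A \<inter> ?R m)"
  proof (rule finite_Lim_measure_incseq)
    show "incseq (\<lambda>m. A \<inter> ?R m)"
      using incseq_reaches_grid[of z u] by (auto simp: incseq_def)
  qed (use u in auto)
  also have "(\<Union>m. A \<inter> ?R m) = A \<inter> reaches z u"
    by (auto simp: reaches_def)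
  finally have lim1: "(\<lambda>m. prob (A \<inter> ?R m)) \<longlonglongrightarrow> prob (A \<inter> reaches z u)" .
  have eq: "prob (A \<inter> ?R m) =
      (\<integral>\<omega>. indicator A \<omega> * grid_hit lam z ((1/2) ^ m) (m * 2 ^ m) (X u \<omega>) \<partial>M)" for m
    by (rule prob_reaches_grid[OF A u]) simp
  have lim2: "(\<lambda>m. prob (A \<inter> ?R m)) \<longlonglongrightarrow> (\<integral>\<omega>. indicator A \<omega> * visit_prob lam z (X u \<omega>) \<partial>M)"
    unfolding eq
  proof (rule integral_dominated_convergence[where w="\<lambda>_. 1"])
    note [measurable] = bounded_measurable_measurable[OF bounded_measurable_visit_prob[OF lam_pos]]
    show "(\<lambda>\<omega>. indicator A \<omega> * visit_prob lam z (X u \<omega>)) \<in> borel_measurable M"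
      using u by measurable
    show "(\<lambda>\<omega>. indicator A \<omega> * grid_hit lam z ((1/2) ^ m) (m * 2 ^ m) (X u \<omega>)) \<in> borel_measurable M" for m
      using u by measurable
    show "AE \<omega> in M. (\<lambda>m. indicator A \<omega> * grid_hit lam z ((1/2) ^ m) (m * 2 ^ m) (X u \<omega>))
        \<longlonglongrightarrow> indicator A \<omega> * visit_prob lam z (X u \<omega>)"
      by (intro AE_I2 tendsto_intros grid_hit_LIMSEQ lam_pos)
    show "AE \<omega> in M. norm (indicator A \<omega> * grid_hit lam z ((1/2) ^ m) (m * 2 ^ m) (X u \<omega>)) \<le> 1" for m
      using grid_hit_bounds[of lam z "(1/2) ^ m" "m * 2 ^ m"] by (auto simp: indicator_def)
  qed simp
  show ?thesis
    by (rule LIMSEQ_unique[OF lim1 lim2])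
qed

section \<open>Almost sure behaviour of the paths\<close>

lemma expectation_X:
  assumes "bounded_measurable \<phi>" "t \<ge> 0"
  shows "(\<integral>\<omega>. \<phi> (X t \<omega>) \<partial>M) = drift_op lam t \<phi> 0"
proof -
  have "space M \<in> sets (past 0)"
    using sets.top[of "past 0"] by simp
  from markov[OF assms(1) this, of t] assms(2)
  have "(\<integral>\<omega>. indicator (space M) \<omega> * \<phi> (X t \<omega>) \<partial>M) = drift_op lam t \<phi> 0 * prob (space M)"
    by (simp add: X_def cong: Bochner_Integration.integral_cong)
  then show ?thesis
    by (simp add: prob_space cong: Bochner_Integration.integral_cong)
qed

text \<open>\<open>reaches\<close> counts time \<open>u\<close> itself, whereas a later visit must
  happen strictly after \<open>u\<close>; excluding \<open>z\<close> as the position at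
  \<open>u\<close> removes the discrepancy.\<close>

lemma AE_X_neq:
  assumes "u \<ge> 0" and "z > 0"
  shows "AE \<omega> in M. X u \<omega> \<noteq> z"
proof (cases "u = 0")
  case True
  then show ?thesis using assms by (simp add: X_def)
next
  case False
  with assms have u: "u > 0" by simp
  have "prob {\<omega>\<in>space M. X u \<omega> = z} = (\<integral>\<omega>. indicator {z} (X u \<omega>) \<partial>M)"
  proof -
    have "(\<integral>\<omega>. indicator {z} (X u \<omega>) \<partial>M) = (\<integral>\<omega>. indicator {\<omega>\<in>space M. X u \<omega> = z} \<omega> \<partial>M :: real)"
      by (intro Bochner_Integration.integral_cong) (auto simp: indicator_def)
    then show ?thesis
      by (simp add: Int_absorb2)
  qed
  also have "\<dots> = drift_op lam u (indicator {z}) 0"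
    using u by (intro expectation_X bounded_measurable_indicator) auto
  also have "\<dots> = (\<integral>\<eta>. indicator {z} \<eta> * normal_density (lam * u) (sqrt u) (\<eta> - 0) \<partial>lborel)"
    using u by (intro drift_op_density) auto
  also have "\<dots> = (\<integral>\<eta>. 0 \<partial>(lborel :: real measure))"
  proof (rule integral_cong_AE)
    show "AE \<eta> in lborel. indicator {z} \<eta> * normal_density (lam * u) (sqrt u) (\<eta> - 0) = 0"
      using AE_lborel_singleton[of z] by eventually_elim simp
  qed auto
  finally have "prob {\<omega>\<in>space M. X u \<omega> = z} = 0" by simp
  then show ?thesis
    using u by (subst (asm) prob_eq_0) auto
qed

text \<open>Staying at or below \<open>z\<close> from \<open>N\<close> on is no likelier than being
  there at any single later time, and that probability tends to 0.\<close>

lemma AE_unbounded: "AE \<omega> in M. \<forall>N. \<exists>n\<ge>N. X (real n) \<omega> > z"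
proof -
  have "AE \<omega> in M. \<exists>n\<ge>N. X (real n) \<omega> > z" for N
  proof -
    let ?A = "{\<omega>\<in>space M. \<forall>n\<in>{N..}. X (real n) \<omega> \<le> z}"
    have A: "?A \<in> events"
      by (intro sets.sets_Collect_countable_Ball) (auto intro!: borel_measurable_le)
    have "prob ?A \<le> drift_op lam (real n) (indicator {..z}) 0" if "n \<ge> N" for n
    proof -
      have "prob ?A = (\<integral>\<omega>. indicator ?A \<omega> \<partial>M)"
        by (auto intro!: arg_cong[where f=prob])
      also have "\<dots> \<le> (\<integral>\<omega>. indicator {..z} (X (real n) \<omega>) \<partial>M)"
        using that A
        by (intro integral_mono integrable_bounded_measurable[where Y="X (real n)"] bounded_measurable_indicator
          integrable_real_indicator) (auto simp: indicator_def less_top[symmetric])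
      also have "\<dots> = drift_op lam (real n) (indicator {..z}) 0"
        by (intro expectation_X bounded_measurable_indicator) auto
      finally show ?thesis .
    qed
    then have "prob ?A \<le> 0"
      by (intro LIMSEQ_le_const[OF drift_op_up_LIMSEQ[OF lam_pos]]) blast
    then have "prob ?A = 0"
      using measure_nonneg[of M ?A] by linarith
    then have "AE \<omega> in M. \<omega> \<notin> ?A"
      using A by (simp add: prob_eq_0)
    then show ?thesis
      by (rule AE_mp) (auto intro!: AE_I2 simp: not_le)
  qed
  then show ?thesis
    by (simp add: AE_all_countable)
qed

lemma AE_regular_path:
  "AE \<omega> in M. continuous_on {0..} (\<lambda>t. X t \<omega>) \<and> (\<forall>t. X t \<omega> = drifted B lam t \<omega>)"
proof -
  have "AE \<omega> in M. B 0 \<omega> = 0" "AE \<omega> in M. continuous_on {0..} (\<lambda>t. B t \<omega>)"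
    using brownian unfolding standard_brownian_motion_def by blast+
  then show ?thesis
    unfolding X_def drifted_def by eventually_elim (auto intro!: continuous_intros)
qed

text \<open>A strict inequality at \<open>t\<close> survives approximation of \<open>t\<close> by
  grid points. Equality would not, so a visit to \<open>z\<close> is detected through levels above
  \<open>z\<close>.\<close>

lemma reaches_near_visit:
  assumes cont: "continuous_on {0..} (\<lambda>t. X t \<omega>)" and \<omega>: "\<omega> \<in> space M"
    and t: "0 \<le> u" "u < t" and less: "X t \<omega> < z"
  shows "\<omega> \<in> reaches z u"
proof -
  \<comment> \<open>Rounding down keeps the grid point at or before \<open>t\<close>, at distance at
    most \<open>(1/2) ^ m\<close>.\<close>
  define k where "k m = nat \<lfloor>(t - u) * 2 ^ m\<rfloor>" for m
  have k: "real (k m) \<le> (t - u) * 2 ^ m" "(t - u) * 2 ^ m < real (k m) + 1" for m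
    using t by (auto simp: k_def)
  have lim: "(\<lambda>m. u + real (k m) * (1/2) ^ m) \<longlonglongrightarrow> t"
  proof (rule tendsto_sandwich)
    have "t - (1/2) ^ m \<le> u + real (k m) * (1/2) ^ m" "u + real (k m) * (1/2) ^ m \<le> t" for m
    proof -
      have "real (k m) / 2 ^ m \<le> t - u" "t - u \<le> (real (k m) + 1) / 2 ^ m"
        using k[of m] by (simp_all add: pos_divide_le_eq pos_le_divide_eq)
      then show "t - (1/2) ^ m \<le> u + real (k m) * (1/2) ^ m" "u + real (k m) * (1/2) ^ m \<le> t"
        by (simp_all add: power_one_over add_divide_distrib)
    qed
    then show "\<forall>\<^sub>F m in sequentially. t - (1/2) ^ m \<le> u + real (k m) * (1/2) ^ m"
      "\<forall>\<^sub>F m in sequentially. u + real (k m) * (1/2) ^ m \<le> t"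
      by auto
    have "(\<lambda>m. t - (1/2) ^ m) \<longlonglongrightarrow> t - 0"
      by (intro tendsto_intros LIMSEQ_power_zero) simp
    then show "(\<lambda>m. t - (1/2) ^ m) \<longlonglongrightarrow> t"
      by simp
  qed simp
  have "(\<lambda>m. X (u + real (k m) * (1/2) ^ m) \<omega>) \<longlonglongrightarrow> X t \<omega>"
    using t by (intro continuous_on_tendsto_compose[OF cont lim]) auto
  then have "\<forall>\<^sub>F m in sequentially. X (u + real (k m) * (1/2) ^ m) \<omega> < z"
    using less by (rule order_tendstoD)
  \<comment> \<open>The grid of stage \<open>m\<close> covers only a horizon of length
    \<open>m\<close>, which must extend beyond \<open>t\<close>.\<close>
  moreover obtain m0 :: nat where "t - u \<le> real m0"
    using real_arch_simple by blast
  then have "\<forall>\<^sub>F m in sequentially. t - u \<le> real m"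
    by (auto intro!: eventually_sequentiallyI[of m0])
  ultimately have "\<forall>\<^sub>F m in sequentially. X (u + real (k m) * (1/2) ^ m) \<omega> < z \<and> t - u \<le> real m"
    by (rule eventually_conj)
  then obtain m where m: "X (u + real (k m) * (1/2) ^ m) \<omega> < z" "t - u \<le> real m"
    using eventually_happens[of _ sequentially] by auto
  have "real (k m) \<le> real m * 2 ^ m"
    using k(1)[of m] m(2) by (meson mult_right_mono order_trans zero_le_numeral zero_le_power)
  then have "k m \<le> m * 2 ^ m"
    by (metis of_nat_le_iff of_nat_mult of_nat_numeral of_nat_power)
  then show ?thesis
    using m(1) \<omega> unfolding reaches_def reaches_grid_def by (auto intro!: less_imp_le)
qed

text \<open>Intermediate values on both sides: a path below \<open>z\<close> at time
  \<open>u\<close> must rise through it later, and a path above \<open>z\<close> crosses it on the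
  way to the grid point found.\<close>

lemma reaches_imp_visit:
  assumes cont: "continuous_on {0..} (\<lambda>t. X t \<omega>)" and u: "0 \<le> u" and neq: "X u \<omega> \<noteq> z"
    and unbounded: "\<forall>N. \<exists>n\<ge>N. X (real n) \<omega> > z" and \<omega>: "\<omega> \<in> reaches z u"
  shows "\<exists>t>u. X t \<omega> = z"
proof -
  have ivt: "\<exists>t>u. X t \<omega> = z" if "v > u" "X u \<omega> < z \<and> z < X v \<omega> \<or> z < X u \<omega> \<and> X v \<omega> \<le> z" for v
  proof -
    have c: "continuous_on {u..v} (\<lambda>t. X t \<omega>)"
      using u by (intro continuous_on_subset[OF cont]) auto
    have "\<exists>t. u \<le> t \<and> t \<le> v \<and> X t \<omega> = z"
      using that IVT'[of "\<lambda>t. X t \<omega>" u z v] IVT2'[of "\<lambda>t. X t \<omega>" v z u] c by force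
    then show ?thesis
      using neq by (metis order_le_less)
  qed
  show ?thesis
  proof (cases "X u \<omega> < z")
    case True
    obtain N :: nat where "u < real N"
      using reals_Archimedean2 by blast
    moreover obtain n where "n \<ge> N" "X (real n) \<omega> > z"
      using unbounded by blast
    ultimately show ?thesis
      using True by (intro ivt[of "real n"]) auto
  next
    case False
    then have gt: "z < X u \<omega>"
      using neq by simp
    obtain m k where "X (u + real k * (1/2) ^ m) \<omega> \<le> z"
      using \<omega> unfolding reaches_def reaches_grid_def by blast
    moreover have "u + real k * (1/2) ^ m \<noteq> u"
      using calculation gt by force
    then have "u < u + real k * (1/2) ^ m"
      by simp
    ultimately show ?thesis
      using gt by (intro ivt) auto
  qed
qed

lemma less_last_passage_iff:
  assumes "u \<ge> 0"
  shows "ereal u < last_passage B lam z \<omega> \<longleftrightarrow> (\<exists>t>u. drifted B lam t \<omega> = z)"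
proof -
  have "ereal u < last_passage B lam z \<omega> \<longleftrightarrow> (\<exists>t\<in>{t. t > 0 \<and> drifted B lam t \<omega> = z}. u < t)"
    unfolding last_passage_def less_Sup_iff by simp
  then show ?thesis
    using assms order_le_less_trans by blast
qed

text \<open>A visit after \<open>u\<close> forces \<open>reaches\<close> for every level
  \<open>z + 1 / real (Suc k)\<close>, that is, membership in \<open>R\<close>. The probabilities of
  these events tend to that of \<open>reaches z u\<close>, so \<open>R\<close> exceeds it by a null
  set only.\<close>

lemma AE_less_last_passage_iff:
  assumes u: "u \<ge> 0" and z: "z > 0"
  shows "AE \<omega> in M. ereal u < last_passage B lam z \<omega> \<longleftrightarrow> \<omega> \<in> reaches z u"
proof -
  let ?z = "\<lambda>k. z + 1 / real (Suc k)"
  define R where "R = (\<Inter>k. reaches (?z k) u)"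
  have R [measurable]: "R \<in> events"
    unfolding R_def using u by (intro sets.countable_INT) auto
  have sub: "reaches z u \<subseteq> R"
    unfolding R_def by (intro INT_greatest reaches_mono) simp
  have prob: "prob (reaches y u) = (\<integral>\<omega>. visit_prob lam y (X u \<omega>) \<partial>M)" for y
  proof -
    have "space M \<in> sets (past u)"
      using sets.top[of "past u"] by simp
    from prob_reaches[OF this u, of y] show ?thesis
      using sets.sets_into_space[OF reaches_events[OF u]]
      by (simp add: Int_absorb1 cong: Bochner_Integration.integral_cong)
  qed
  have "(\<lambda>k. prob (reaches (?z k) u)) \<longlonglongrightarrow> prob (reaches z u)"
    unfolding prob
  proof (rule integral_dominated_convergence[where w="\<lambda>_. 1"])
    note [measurable] = bounded_measurable_measurable[OF bounded_measurable_visit_prob[OF lam_pos]]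
    show "(\<lambda>\<omega>. visit_prob lam z (X u \<omega>)) \<in> borel_measurable M" "(\<lambda>\<omega>. visit_prob lam (?z k) (X u \<omega>)) \<in> borel_measurable M" for k
      using u by measurable
    have "?z \<longlonglongrightarrow> z + 0"
      by (intro tendsto_intros LIMSEQ_inverse_real_of_nat[unfolded inverse_eq_divide])
    then have "(\<lambda>k. visit_prob lam (?z k) x) \<longlonglongrightarrow> visit_prob lam z x" for x
      unfolding visit_prob_def alpha_def by (auto intro!: tendsto_intros)
    then show "AE \<omega> in M. (\<lambda>k. visit_prob lam (?z k) (X u \<omega>)) \<longlonglongrightarrow> visit_prob lam z (X u \<omega>)"
      by simp
    show "AE \<omega> in M. norm (visit_prob lam (?z k) (X u \<omega>)) \<le> 1" for k
      using visit_prob_le_1[OF lam_pos] by (simp add: less_imp_le)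
  qed simp
  moreover have "prob R \<le> prob (reaches (?z k) u)" for k
    using u by (intro finite_measure_mono) (auto simp: R_def)
  ultimately have "prob R \<le> prob (reaches z u)"
    by (intro LIMSEQ_le_const) auto
  moreover have "prob (R - reaches z u) = prob R - prob (reaches z u)"
    using u sub by (intro finite_measure_Diff) auto
  ultimately have "prob (R - reaches z u) = 0"
    using measure_nonneg[of M "R - reaches z u"] by linarith
  then have "AE \<omega> in M. \<omega> \<notin> R - reaches z u"
    using u by (subst (asm) prob_eq_0) auto
  then show ?thesis
    using AE_regular_path AE_X_neq[OF u z] AE_unbounded[of z] AE_space
  proof eventually_elim
    case (elim \<omega>)
    then have cont: "continuous_on {0..} (\<lambda>t. X t \<omega>)" and eq: "\<And>t. drifted B lam t \<omega> = X t \<omega>"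
      by auto
    show ?case
      unfolding less_last_passage_iff[OF u] eq
    proof
      assume "\<exists>t>u. X t \<omega> = z"
      then have "\<omega> \<in> R"
        using reaches_near_visit[OF cont] elim u unfolding R_def by (auto simp del: of_nat_Suc)
      then show "\<omega> \<in> reaches z u"
        using elim by blast
    next
      assume "\<omega> \<in> reaches z u"
      then show "\<exists>t>u. X t \<omega> = z"
        using elim u by (intro reaches_imp_visit[OF cont]) auto
    qed
  qed
qed

end

section \<open>The stopped process\<close>

context brownian_motion begin

lemma subalgebra_past: "subalgebra M (past u)"
  using sets_past_subset by (simp add: subalgebra_def)

text \<open>Passes from sets of the past to the weight \<open>\<phi> (X u)\<close>:
  \<open>visit_prob\<close> at the current position is the conditional probability of
  \<open>reaches\<close>.\<close>

lemma expectation_reaches: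
  assumes A: "A \<in> sets (past u)" and \<phi>: "bounded_measurable \<phi>" and u: "u \<ge> 0"
  shows "(\<integral>\<omega>. indicator A \<omega> * \<phi> (X u \<omega>) * indicator (reaches z u) \<omega> \<partial>M) =
    (\<integral>\<omega>. indicator A \<omega> * (\<phi> (X u \<omega>) * visit_prob lam z (X u \<omega>)) \<partial>M)"
proof -
  interpret past: finite_measure_subalgebra M "past u"
    by unfold_locales (rule subalgebra_past)
  note g = bounded_measurable_visit_prob[OF lam_pos, of z]
  note [measurable] = bounded_measurable_measurable[OF g] bounded_measurable_measurable[OF \<phi>]
    X_past[OF u order_refl] reaches_events[OF u] X_measurable[OF u]
  have A' [measurable]: "A \<in> events"
    using A sets_past_subset by blast
  have cond: "AE \<omega> in M. real_cond_exp M (past u) (indicator (reaches z u)) \<omega> = visit_prob lam z (X u \<omega>)"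
  proof (rule past.real_cond_exp_charact)
    fix D assume D: "D \<in> sets (past u)"
    then have D': "D \<in> events"
      using sets_past_subset by blast
    have "(\<integral>\<omega>\<in>D. indicator (reaches z u) \<omega> \<partial>M) = (\<integral>\<omega>. indicator (D \<inter> reaches z u) \<omega> \<partial>M :: real)"
      unfolding set_lebesgue_integral_def by (simp add: indicator_inter_arith)
    also have "\<dots> = prob (D \<inter> reaches z u)"
      using sets.sets_into_space[OF D'] by (simp add: Int_absorb2 le_infI1)
    also have "\<dots> = (\<integral>\<omega>. indicator D \<omega> * visit_prob lam z (X u \<omega>) \<partial>M)"
      by (rule prob_reaches[OF D u])
    finally show "(\<integral>\<omega>\<in>D. indicator (reaches z u) \<omega> \<partial>M) = (\<integral>\<omega>\<in>D. visit_prob lam z (X u \<omega>) \<partial>M)"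
      unfolding set_lebesgue_integral_def by simp
  qed (auto intro!: integrable_bounded_measurable[OF g] integrable_real_indicator simp: less_top[symmetric])
  have int: "integrable M (\<lambda>\<omega>. indicator A \<omega> * \<phi> (X u \<omega>))"
    by (intro integrable_indicator_mult \<phi>) auto
  have "(\<integral>\<omega>. indicator A \<omega> * \<phi> (X u \<omega>) * indicator (reaches z u) \<omega> \<partial>M) =
      (\<integral>\<omega>. indicator A \<omega> * \<phi> (X u \<omega>) * real_cond_exp M (past u) (indicator (reaches z u)) \<omega> \<partial>M)"
    using A by (intro past.real_cond_exp_intg(2)[symmetric] integrable_real_mult_indicator int) auto
  also have "\<dots> = (\<integral>\<omega>. indicator A \<omega> * (\<phi> (X u \<omega>) * visit_prob lam z (X u \<omega>)) \<partial>M)"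
    using cond by (intro integral_cong_AE) (auto elim!: eventually_mono)
  finally show ?thesis .
qed

text \<open>A later visit is traded for the weight \<open>visit_prob\<close> at time
  \<open>s + t\<close>, the Markov property carries it back to time \<open>s\<close>, and there the
  weight is traded for the event again.\<close>

lemma h_transform_expectation:
  assumes A: "A \<in> sets (past s)" and \<phi>: "bounded_measurable \<phi>" and s: "s \<ge> 0" and t: "t \<ge> 0"
    and \<psi>: "bounded_measurable \<psi>"
    and eq: "\<And>x. \<psi> x * visit_prob lam z x = drift_op lam t (\<lambda>\<eta>. \<phi> \<eta> * visit_prob lam z \<eta>) x"
  shows "(\<integral>\<omega>. indicator A \<omega> * \<phi> (X (s + t) \<omega>) * indicator (reaches z (s + t)) \<omega> \<partial>M) =
    (\<integral>\<omega>. indicator A \<omega> * \<psi> (X s \<omega>) * indicator (reaches z s) \<omega> \<partial>M)"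
proof -
  have A': "A \<in> sets (past (s + t))"
    using A sets_past_mono[of s "s + t"] t by auto
  have "(\<integral>\<omega>. indicator A \<omega> * \<phi> (X (s + t) \<omega>) * indicator (reaches z (s + t)) \<omega> \<partial>M) =
      (\<integral>\<omega>. indicator A \<omega> * (\<lambda>\<eta>. \<phi> \<eta> * visit_prob lam z \<eta>) (X (s + t) \<omega>) \<partial>M)"
    using s t by (intro expectation_reaches A' \<phi>) auto
  also have "\<dots> = (\<integral>\<omega>. indicator A \<omega> * drift_op lam t (\<lambda>\<eta>. \<phi> \<eta> * visit_prob lam z \<eta>) (X s \<omega>) \<partial>M)"
    by (intro markov bounded_measurable_mult \<phi> bounded_measurable_visit_prob lam_pos A s t)
  also have "\<dots> = (\<integral>\<omega>. indicator A \<omega> * \<psi> (X s \<omega>) * indicator (reaches z s) \<omega> \<partial>M)"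
    unfolding eq[symmetric] by (intro expectation_reaches[symmetric] A \<psi> s)
  finally show ?thesis .
qed

end

lemma bounded_measurable_on_Q_semigroup:
  assumes h: "h \<in> bounded_measurable_on state_space" and t: "t \<ge> 0" and lam: "lam > 0"
  shows "Q_semigroup lam z t h \<in> bounded_measurable_on state_space"
proof -
  let ?E = "borel_on state_space"
  obtain \<kappa> where \<kappa>: "\<kappa> \<in> ?E \<rightarrow>\<^sub>M prob_algebra ?E"
    and Q: "\<And>y. y \<in> state_space \<Longrightarrow> Q_semigroup lam z t h y = (\<integral>x. h x \<partial>\<kappa> y)"
    using Q_semigroup_kernel[OF t lam, of z] h by blast
  have hm: "h \<in> borel_measurable ?E"
    using h by (simp add: bounded_measurable_on_def)
  obtain C where C: "\<And>y. y \<in> state_space \<Longrightarrow> \<bar>h y\<bar> \<le> C"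
    using h by (auto simp: bounded_measurable_on_def bounded_iff)
  have "(\<lambda>y. \<integral>x. h x \<partial>\<kappa> y) \<in> borel_measurable ?E"
    by (rule measurable_compose[OF measurable_prob_algebraD[OF \<kappa>] integral_measurable_subprob_algebra[OF hm]])
  moreover have "(\<lambda>y. \<integral>x. h x \<partial>\<kappa> y) \<in> borel_measurable ?E \<longleftrightarrow> Q_semigroup lam z t h \<in> borel_measurable ?E"
    by (intro measurable_cong) (simp add: Q space_restrict_space)
  ultimately have "Q_semigroup lam z t h \<in> borel_measurable ?E"
    by simp
  moreover have "\<bar>Q_semigroup lam z t h y\<bar> \<le> C" if y: "y \<in> state_space" for y
  proof -
    have "\<kappa> y \<in> space (prob_algebra ?E)"
      using measurable_space[OF \<kappa>] y by (simp add: space_restrict_space)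
    then have sets: "sets (\<kappa> y) = sets ?E" and "prob_space (\<kappa> y)"
      by (auto simp: space_prob_algebra)
    then interpret K: prob_space "\<kappa> y" by simp
    have sp: "space (\<kappa> y) = state_space"
      using sets_eq_imp_space_eq[OF sets] by (simp add: space_restrict_space)
    have int: "integrable (\<kappa> y) h"
      using hm C by (intro K.integrable_const_bound[where B=C]) (auto simp: sp measurable_cong_sets[OF sets refl])
    have "\<bar>\<integral>x. h x \<partial>\<kappa> y\<bar> \<le> (\<integral>x. C \<partial>\<kappa> y)"
      using int C by (intro order_trans[OF integral_abs_bound] integral_mono) (auto simp: sp)
    then show ?thesis
      by (simp add: Q[OF y] K.prob_space)
  qed
  ultimately show ?thesis
    unfolding bounded_measurable_on_def bounded_iff by (auto intro!: exI[of _ C] simp del: split_paired_All)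
qed

lemma zeta_state_space [simp]: "zeta B lam z t \<omega> \<in> state_space"
  by (simp add: zeta_def state_space_def)

locale complete_brownian_motion = brownian_motion + complete_measure M +
  fixes z :: real
  assumes z_pos: "z > 0"
begin

abbreviation Z :: "real \<Rightarrow> 'a \<Rightarrow> real \<times> real" where
  "Z \<equiv> zeta B lam z"

abbreviation F :: "real \<Rightarrow> 'a measure" where
  "F \<equiv> completed_natural_filtration M state_space Z"

text \<open>Holds only almost surely, since grids started at \<open>u\<close> and at
  \<open>v\<close> need not share points; the last passage time mediates.\<close>

lemma AE_reaches_antimono:
  assumes "0 \<le> u" "u \<le> v"
  shows "AE \<omega> in M. \<omega> \<in> reaches z v \<longrightarrow> \<omega> \<in> reaches z u"
  using AE_less_last_passage_iff[OF assms(1) z_pos] AE_less_last_passage_iff[OF order_trans[OF assms] z_pos]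
proof eventually_elim
  case (elim \<omega>)
  then show ?case
    using order_le_less_trans[of "ereal u" "ereal v"] assms by auto
qed

text \<open>The motion starts at 0, below \<open>z\<close>, where the visit probability is 1. This
  excludes the value of the empty supremum.\<close>

lemma AE_last_passage_pos: "AE \<omega> in M. last_passage B lam z \<omega> > 0"
proof -
  have "space M \<in> sets (past 0)"
    using sets.top[of "past 0"] by simp
  from prob_reaches[OF this order_refl, of z]
  have "prob (reaches z 0) = (\<integral>\<omega>. visit_prob lam z 0 \<partial>M)"
    using sets.sets_into_space[OF reaches_events[of 0 z]]
    by (simp add: Int_absorb1 X_def cong: Bochner_Integration.integral_cong)
  then have "prob (reaches z 0) = 1"
    using z_pos by (simp add: visit_prob_eq prob_space)
  then have "AE \<omega> in M. \<omega> \<in> reaches z 0"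
    by (simp add: prob_eq_1)
  then show ?thesis
    using AE_less_last_passage_iff[OF order_refl z_pos] by eventually_elim (simp add: zero_ereal_def)
qed

lemma last_passage_attained:
  assumes cont: "continuous_on {0..} (\<lambda>t. X t \<omega>)" and eq: "\<And>t. drifted B lam t \<omega> = X t \<omega>"
    and pos: "last_passage B lam z \<omega> > 0" and le: "last_passage B lam z \<omega> \<le> ereal u"
  shows "drifted B lam (real_of_ereal (last_passage B lam z \<omega>)) \<omega> = z"
proof -
  define S where "S = {t. t > 0 \<and> X t \<omega> = z}"
  have lp: "last_passage B lam z \<omega> = Sup (ereal ` S)"
    by (simp add: last_passage_def S_def eq)
  have "S = {t\<in>{0..}. X t \<omega> = z}"
    using z_pos by (auto simp: S_def X_def order_le_less)
  then have "closed S"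
    using continuous_closed_preimage_constant[OF cont closed_atLeast] by simp
  moreover have "S \<noteq> {}"
    using pos by (auto simp: lp bot_ereal_def)
  moreover have upper: "t \<le> u" if "t \<in> S" for t
    using order_trans[OF Sup_upper[of "ereal t" "ereal ` S"] le[unfolded lp]] that by auto
  then have bdd: "bdd_above S"
    by (auto simp: bdd_above_def)
  ultimately have "Sup S \<in> S"
    by (intro closed_contains_Sup) auto
  moreover have "Sup (ereal ` S) = ereal (Sup S)"
    using \<open>Sup S \<in> S\<close> bdd by (intro cSup_eq_maximum) (auto intro: cSup_upper)
  ultimately show ?thesis
    by (simp add: lp eq) (simp add: S_def)
qed

lemma AE_zeta:
  assumes u: "u \<ge> 0"
  shows "AE \<omega> in M. Z u \<omega> = (if \<omega> \<in> reaches z u then (1, X u \<omega>) else (0, z))"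
  using AE_regular_path AE_last_passage_pos AE_less_last_passage_iff[OF u z_pos]
proof eventually_elim
  case (elim \<omega>)
  show ?case
  proof (cases "ereal u < last_passage B lam z \<omega>")
    case True
    then show ?thesis
      using elim by (auto simp: zeta_def xi_def min_def less_imp_le)
  next
    case False
    then have le: "last_passage B lam z \<omega> \<le> ereal u"
      by simp
    have "drifted B lam (real_of_ereal (last_passage B lam z \<omega>)) \<omega> = z"
      by (rule last_passage_attained[OF _ _ _ le]) (use elim in metis)+
    then have "Z u \<omega> = (0, z)"
      using False le by (simp add: zeta_def xi_def min_absorb2)
    then show ?thesis
      using False elim by simp
  qed
qed

text \<open>The supremum over uncountably many times is not visibly measurable; completeness
  transfers measurability from the almost sure description.\<close>

lemma Z_measurable:
  assumes u: "u \<ge> 0" shows "Z u \<in> M \<rightarrow>\<^sub>M borel_on state_space"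
proof (rule measurable_restrict_space2)
  let ?Z = "\<lambda>\<omega>. if \<omega> \<in> reaches z u then (1 :: real, X u \<omega>) else (0, z)"
  have "?Z \<in> M \<rightarrow>\<^sub>M borel \<Otimes>\<^sub>M borel"
    using u by measurable
  then have meas: "?Z \<in> M \<rightarrow>\<^sub>M borel"
    by (simp add: borel_prod)
  show "Z u \<in> M \<rightarrow>\<^sub>M borel"
  proof (rule measurableI)
    fix A :: "(real \<times> real) set" assume "A \<in> sets borel"
    then have Z': "?Z -` A \<inter> space M \<in> events"
      by (rule measurable_sets[OF meas])
    have "AE \<omega> in M. \<omega> \<in> ?Z -` A \<inter> space M \<longleftrightarrow> \<omega> \<in> Z u -` A \<inter> space M"
      using AE_zeta[OF u] by eventually_elim auto
    then show "Z u -` A \<inter> space M \<in> events"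
      by (rule in_sets_AE[OF _ Z']) simp
  qed simp
qed simp

section \<open>The completed natural filtration\<close>

lemma space_F [simp]: "space (F t) = space M"
  by (simp add: completed_natural_filtration_def space_measure_of_conv)

abbreviation F_generator :: "real \<Rightarrow> 'a set set" where
  "F_generator t \<equiv>
    {Z s -` A \<inter> space M | s A. s \<in> {0..t} \<and> A \<in> sets (borel_on state_space)} \<union> null_sets M"

lemma sets_F: "sets (F t) = sigma_sets (space M) (F_generator t)"
proof -
  have "F_generator t \<subseteq> Pow (space M)"
    using sets.sets_into_space by (auto simp: null_sets_def)
  then show ?thesis
    by (simp add: completed_natural_filtration_def sets_measure_of)
qed

lemma filtration_F: "filtration (space M) F"
proof
  fix i j :: real assume ij: "i \<le> j"
  have "F_generator i \<subseteq> F_generator j"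
  proof
    fix A assume "A \<in> F_generator i"
    then show "A \<in> F_generator j"
    proof
      assume "A \<in> {Z s -` A \<inter> space M | s A. s \<in> {0..i} \<and> A \<in> sets (borel_on state_space)}"
      then obtain s D where "A = Z s -` D \<inter> space M" "s \<in> {0..i}" "D \<in> sets (borel_on state_space)"
        by blast
      then show ?thesis
        using ij by (intro UnI1 CollectI exI[of _ s] exI[of _ D]) auto
    qed simp
  qed
  then show "sets (F i) \<subseteq> sets (F j)"
    unfolding sets_F by (rule sigma_sets_mono')
qed simp

lemma subalgebra_F: "subalgebra M (F t)"
proof -
  have "F_generator t \<subseteq> events"
    using measurable_sets[OF Z_measurable] by auto
  then show ?thesis
    unfolding subalgebra_def sets_F by (simp add: sets.sigma_sets_subset)
qed

lemma Z_adapted: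
  assumes "t \<ge> 0" shows "Z t \<in> F t \<rightarrow>\<^sub>M borel_on state_space"
proof (rule measurableI)
  fix A assume "A \<in> sets (borel_on state_space)"
  then have "Z t -` A \<inter> space M \<in> F_generator t"
    using assms by (intro UnI1 CollectI exI[of _ t] exI[of _ A]) auto
  then show "Z t -` A \<inter> space (F t) \<in> sets (F t)"
    unfolding sets_F by (auto intro: sigma_sets.Basic)
qed (simp add: space_restrict_space)

text \<open>If a visit after \<open>s\<close> is still to come, then one is still to come after each
  \<open>u \<le> s\<close>, so \<open>Z u\<close> is \<open>(1, X u)\<close> almost surely. Null
  sets are matched with the empty set, and the property passes to complements and countable
  unions.\<close>

lemma F_trace:
  assumes "A \<in> sets (F s)"
  shows "\<exists>A'\<in>sets (past s). AE \<omega> in M. \<omega> \<in> reaches z s \<longrightarrow> (\<omega> \<in> A \<longleftrightarrow> \<omega> \<in> A')"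
  using assms unfolding sets_F
proof (induction rule: sigma_sets.induct)
  case (Basic A)
  then show ?case
  proof
    assume "A \<in> {Z s' -` A \<inter> space M | s' A. s' \<in> {0..s} \<and> A \<in> sets (borel_on state_space)}"
    then obtain u D where A: "A = Z u -` D \<inter> space M" and u: "0 \<le> u" "u \<le> s"
      and D: "D \<in> sets (borel_on state_space)"
      by auto
    have "Pair (1::real) \<in> borel \<rightarrow>\<^sub>M borel_on state_space"
      by (intro measurable_restrict_space2) (auto simp: state_space_def)
    from measurable_sets[OF measurable_compose[OF X_past[OF u] this] D]
    have "(\<lambda>\<omega>. (1, X u \<omega>)) -` D \<inter> space M \<in> sets (past s)"
      by simp
    moreover have "AE \<omega> in M. \<omega> \<in> reaches z s \<longrightarrow> (\<omega> \<in> A \<longleftrightarrow> \<omega> \<in> (\<lambda>\<omega>. (1, X u \<omega>)) -` D \<inter> space M)"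
      using AE_zeta[OF u(1)] AE_reaches_antimono[OF u] by eventually_elim (auto simp: A)
    ultimately show ?thesis by blast
  next
    assume "A \<in> null_sets M"
    then have "AE \<omega> in M. \<omega> \<in> reaches z s \<longrightarrow> (\<omega> \<in> A \<longleftrightarrow> \<omega> \<in> {})"
      using AE_not_in[of A M] by (auto elim!: eventually_mono)
    then show ?thesis by blast
  qed
next
  case Empty
  show ?case by (intro bexI[of _ "{}"]) auto
next
  case (Compl A)
  then obtain A' where A': "A' \<in> sets (past s)" "AE \<omega> in M. \<omega> \<in> reaches z s \<longrightarrow> (\<omega> \<in> A \<longleftrightarrow> \<omega> \<in> A')"
    by blast
  have "space M - A' \<in> sets (past s)"
    using sets.compl_sets[OF A'(1)] by simp
  moreover have "AE \<omega> in M. \<omega> \<in> reaches z s \<longrightarrow> (\<omega> \<in> space M - A \<longleftrightarrow> \<omega> \<in> space M - A')"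
    using A'(2) by eventually_elim auto
  ultimately show ?case by blast
next
  case (Union A)
  then obtain A' where A': "\<And>i. A' i \<in> sets (past s)"
    "\<And>i. AE \<omega> in M. \<omega> \<in> reaches z s \<longrightarrow> (\<omega> \<in> A i \<longleftrightarrow> \<omega> \<in> A' i)"
    by metis
  have "AE \<omega> in M. \<forall>i. \<omega> \<in> reaches z s \<longrightarrow> (\<omega> \<in> A i \<longleftrightarrow> \<omega> \<in> A' i)"
    using A'(2) unfolding AE_all_countable by blast
  then have "AE \<omega> in M. \<omega> \<in> reaches z s \<longrightarrow> (\<omega> \<in> (\<Union>i. A i) \<longleftrightarrow> \<omega> \<in> (\<Union>i. A' i))"
    by eventually_elim auto
  moreover have "(\<Union>i. A' i) \<in> sets (past s)"
    using A'(1) by auto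
  ultimately show ?case by blast
qed

text \<open>Both sides equal \<open>h (0, z)\<close> once the path has stopped. Subtracting this
  value confines the comparison to the event \<open>reaches z s\<close>, where \<open>A\<close> can
  be exchanged for a set of the past, and the h-transform identity finishes it.\<close>

lemma Z_conditional_expectation:
  assumes s: "s \<ge> 0" and t: "t \<ge> 0" and h: "h \<in> bounded_measurable_on state_space"
  shows "AE \<omega> in M. real_cond_exp M (F s) (\<lambda>\<omega>. h (Z (s + t) \<omega>)) \<omega> = Q_semigroup lam z t h (Z s \<omega>)"
proof -
  interpret F: finite_measure_subalgebra M "F s"
    by unfold_locales (rule subalgebra_F)
  let ?Q = "Q_semigroup lam z t h"
  have Q: "?Q \<in> bounded_measurable_on state_space"
    by (rule bounded_measurable_on_Q_semigroup[OF h t lam_pos])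
  have st: "s + t \<ge> 0"
    using s t by simp
  have int: "integrable M (\<lambda>\<omega>. k (Z u \<omega>))" if k: "k \<in> bounded_measurable_on state_space" and u: "u \<ge> 0" for k u
  proof -
    obtain C where "\<And>y. y \<in> state_space \<Longrightarrow> \<bar>k y\<bar> \<le> C"
      using k by (auto simp: bounded_measurable_on_def bounded_iff)
    then show ?thesis
      using k measurable_compose[OF Z_measurable[OF u], of k borel]
      by (intro integrable_const_bound[where B=C]) (auto simp: bounded_measurable_on_def)
  qed
  note h1 = bounded_measurable_section[OF h, of 1, simplified]
  note Q1 = bounded_measurable_section[OF Q, of 1, simplified]
  define \<phi> where "\<phi> \<eta> = h (1, \<eta>) + - h (0, z)" for \<eta>
  define \<psi> where "\<psi> \<eta> = ?Q (1, \<eta>) + - h (0, z)" for \<eta>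
  have \<phi>: "bounded_measurable \<phi>" and \<psi>: "bounded_measurable \<psi>"
    unfolding \<phi>_def \<psi>_def by (intro bounded_measurable_add bounded_measurable_const h1 Q1)+
  \<comment> \<open>The terms \<open>h (0, z) * visit_prob lam z x\<close> cancel, which leaves the
    operator applied to \<phi> times the visit probability.\<close>
  have eq: "\<psi> x * visit_prob lam z x = drift_op lam t (\<lambda>\<eta>. \<phi> \<eta> * visit_prob lam z \<eta>) x" for x
  proof -
    note g = bounded_measurable_visit_prob[OF lam_pos, of z]
    have "(\<lambda>\<eta>. \<phi> \<eta> * visit_prob lam z \<eta>) = (\<lambda>\<eta>. h (1, \<eta>) * visit_prob lam z \<eta> + (- h (0, z)) * visit_prob lam z \<eta>)"
      by (auto simp: \<phi>_def algebra_simps)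
    then have "drift_op lam t (\<lambda>\<eta>. \<phi> \<eta> * visit_prob lam z \<eta>) x =
        drift_op lam t (\<lambda>\<eta>. h (1, \<eta>) * visit_prob lam z \<eta>) x + - h (0, z) * drift_op lam t (visit_prob lam z) x"
      by (simp only: drift_op_add drift_op_cmult bounded_measurable_mult bounded_measurable_const h1 g)
    then show ?thesis
      unfolding \<psi>_def Q_semigroup_1[OF bounded_measurable_measurable[OF h1] t lam_pos]
      by (simp add: algebra_simps)
  qed
  show ?thesis
  proof (rule F.real_cond_exp_charact)
    show "integrable M (\<lambda>\<omega>. h (Z (s + t) \<omega>))" "integrable M (\<lambda>\<omega>. ?Q (Z s \<omega>))"
      by (intro int h Q s st)+
    show "(\<lambda>\<omega>. ?Q (Z s \<omega>)) \<in> borel_measurable (F s)"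
      using Q by (intro measurable_compose[OF Z_adapted[OF s]]) (simp add: bounded_measurable_on_def)
    fix A assume A: "A \<in> sets (F s)"
    then have A_ev: "A \<in> events"
      using subalgebra_F by (auto simp: subalgebra_def)
    obtain A' where A': "A' \<in> sets (past s)" "AE \<omega> in M. \<omega> \<in> reaches z s \<longrightarrow> (\<omega> \<in> A \<longleftrightarrow> \<omega> \<in> A')"
      using F_trace[OF A] by blast
    have A'_ev: "A' \<in> events"
      using A'(1) sets_past_subset by blast
    let ?f = "\<lambda>\<omega>. indicator A' \<omega> * \<phi> (X (s + t) \<omega>) * indicator (reaches z (s + t)) \<omega>"
    let ?g = "\<lambda>\<omega>. indicator A' \<omega> * \<psi> (X s \<omega>) * indicator (reaches z s) \<omega>"
    have int_f: "integrable M ?f" and int_g: "integrable M ?g"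
      by (rule integrable_real_mult_indicator[OF reaches_events integrable_indicator_mult[OF A'_ev _ X_measurable]];
          use s st \<phi> \<psi> in simp)+
    have int_A: "integrable M (\<lambda>\<omega>. indicator A \<omega> * h (Z (s + t) \<omega>))" "integrable M (\<lambda>\<omega>. indicator A \<omega> * ?Q (Z s \<omega>))"
      using integrable_real_mult_indicator[OF A_ev int[OF h st]] integrable_real_mult_indicator[OF A_ev int[OF Q s]]
      by (simp_all add: mult.commute)
    \<comment> \<open>Off \<open>reaches z s\<close> both sides vanish; between the two times, a
      path already stopped contributes only through \<psi>.\<close>
    have "AE \<omega> in M. indicator A \<omega> * h (Z (s + t) \<omega>) - indicator A \<omega> * ?Q (Z s \<omega>) = ?f \<omega> - ?g \<omega>"
      using AE_zeta[OF s] AE_zeta[OF st] AE_reaches_antimono[OF s, of "s + t"] A'(2) t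
      by (auto elim!: eventually_elim2 simp: indicator_def \<phi>_def \<psi>_def Q_semigroup_0)
    then have "(\<integral>\<omega>. indicator A \<omega> * h (Z (s + t) \<omega>) - indicator A \<omega> * ?Q (Z s \<omega>) \<partial>M) = (\<integral>\<omega>. ?f \<omega> - ?g \<omega> \<partial>M)"
      using int_f int_g int_A by (intro integral_cong_AE) auto
    also have "\<dots> = 0"
      using int_f int_g h_transform_expectation[OF A'(1) \<phi> s t \<psi> eq] by simp
    finally show "(\<integral>\<omega>\<in>A. h (Z (s + t) \<omega>) \<partial>M) = (\<integral>\<omega>\<in>A. ?Q (Z s \<omega>) \<partial>M)"
      using int_A unfolding set_lebesgue_integral_def by simp
  qed
qed

end

theorem theorem5p2:
  fixes M :: "'a measure" and B :: "real \<Rightarrow> 'a \<Rightarrow> real" and lam z :: real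
  assumes "prob_space M" and "complete_measure M"
    and "standard_brownian_motion M B"
    and "lam > 0" and "z > 0"
  shows "feller_process M
           (completed_natural_filtration M state_space (zeta B lam z))
           state_space (Q_semigroup lam z) (zeta B lam z)"
proof -
  interpret prob_space M by fact
  interpret complete_measure M by fact
  interpret complete_brownian_motion M B lam z
    by unfold_locales fact+
  show ?thesis
    unfolding feller_process_def markov_process_def
    by (intro conjI allI ballI impI filtration_F subalgebra_F Z_adapted Z_conditional_expectation
        markov_semigroup_on_Q_semigroup Q_semigroup_tendsto_0 Q_semigroup_C0 assms)
qed

end
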